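(* Let $\mathcal{A}$ be a Hopf $^*$-algebra, let $\alpha:\mathcal{A}\to\mathcal{A}$ be an admissible bijection, and put $S_\alpha:=S\circ\alpha$. There exists a one-to-one correspondence between unitary equivalence classes of $\alpha$-real cocycles $\eta$ on $\mathcal{A}$ and $S_\alpha$-invariant generating functionals $L$ on $\mathcal{A}$, such that, given an $S_\alpha$-invariant generating functional $L$, the corresponding $\alpha$-real cocycle $\eta$ yields the coboundary of $L$.
   Context: Inner products are linear in the second variable. $\mathcal{A}$ is a Hopf $^*$-algebra over $\mathbb{C}$ with coproduct $\Delta$, counit $\epsilon$, antipode $S$; $K_1=\ker\epsilon$. Admissible bijection: a map $\alpha:\mathcal{A}\to\mathcal{A}$ such that (i) $\alpha$ is an algebra homomorphism; (ii) $\alpha\circ{}^*\circ\alpha\circ{}^*=\mathrm{id}$; (iii) $(\alpha\otimes\alpha)\circ\Delta=\Delta\circ\alpha$; (iv) the linear map $\mathrm{id}+\alpha:\mathcal{A}\to\mathcal{A}$ is a bijection; (v) the linear map $\mathrm{id}\otimes\mathrm{id}+\alpha\otimes\alpha:\mathcal{A}\otimes\mathcal{A}\to\mathcal{A}\otimes\mathcal{A}$ is a bijection. Representation of $\mathcal{A}$ on a pre-Hilbert space $D$: a unital $^*$-homomorphism from $\mathcal{A}$ to $\mathcal{L}^\dagger(D)$, the $^*$-algebra of linear operators $D\to D$ having an adjoint that is defined on $D$ and maps $D$ into $D$. Cocycle: a linear map $\eta:\mathcal{A}\to D$ ($D$ a pre-Hilbert space) for which there is a representation $\pi$ of $\mathcal{A}$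 on $D$ with $\eta(ab)=\pi(a)\eta(b)+\eta(a)\epsilon(b)$ for all $a,b\in\mathcal{A}$, and such that $\eta(\mathcal{A})$ is dense in $D$. The cocycle $\eta$ is $\alpha$-real if $\langle\eta(a),\eta(b)\rangle=\langle\eta(S_\alpha(b)^* ),\eta(S_\alpha(a^* ))\rangle$ for all $a,b\in\mathcal{A}$. Two cocycles $\eta_1:\mathcal{A}\to D_1$, $\eta_2:\mathcal{A}\to D_2$ are unitarily equivalent if there is a unitary $U$ between the Hilbert space completions of $D_1$ and $D_2$ with $\eta_2(a)=U\eta_1(a)$ for all $a\in\mathcal{A}$. Generating functional: a linear functional $L:\mathcal{A}\to\mathbb{C}$ with $L(a^*a)\ge 0$ for $a\in K_1$, $L(b^* )=\overline{L(b)}$ for $b\in\mathcal{A}$, and $L(1)=0$. It is $S_\alpha$-invariant if $L\circ S_\alpha=L$. $\eta$ yields the coboundary of $L$ if $L(ab)=\epsilon(a)L(b)+L(a)\epsilon(b)+\langle\eta(a^* ),\eta(b)\rangle$ for all $a,b\in\mathcal{A}$. *)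

theory Defs
  imports Complex_Main "HOL-Library.Poly_Mapping" "HOL-Library.Nonpos_Ints"
begin

section \<open>Complex vector spaces and unital *-algebras\<close>

class scaleC =
  fixes scaleC :: "complex \<Rightarrow> 'a \<Rightarrow> 'a"  (infixr \<open>*\<^sub>C\<close> 75)

class complex_vector = scaleC + ab_group_add +
  assumes scaleC_add_right: "c *\<^sub>C (x + y) = c *\<^sub>C x + c *\<^sub>C y"
    and scaleC_add_left: "(c + d) *\<^sub>C x = c *\<^sub>C x + d *\<^sub>C x"
    and scaleC_scaleC [simp]: "c *\<^sub>C (d *\<^sub>C x) = (c * d) *\<^sub>C x"
    and scaleC_one [simp]: "1 *\<^sub>C x = x"

global_interpretation complex_vector: vector_space "scaleC :: complex \<Rightarrow> 'a \<Rightarrow> 'a::complex_vector"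
  by unfold_locales (auto simp: scaleC_add_right scaleC_add_left)

abbreviation clinear :: "('a::complex_vector \<Rightarrow> 'b::complex_vector) \<Rightarrow> bool"
  where "clinear \<equiv> Vector_Spaces.linear scaleC scaleC"

lemma clinear_iff:
  "clinear f \<longleftrightarrow> (\<forall>x y. f (x + y) = f x + f y) \<and> (\<forall>c x. f (c *\<^sub>C x) = c *\<^sub>C f x)"
  unfolding Vector_Spaces.linear_iff
  by (auto simp: complex_vector.vector_space_axioms)

class complex_star_algebra = complex_vector + ring_1 +
  fixes star :: "'a \<Rightarrow> 'a"
  assumes mult_scaleC_left: "(c *\<^sub>C x) * y = c *\<^sub>C (x * y)"
    and mult_scaleC_right: "x * (c *\<^sub>C y) = c *\<^sub>C (x * y)"
    and star_add: "star (x + y) = star x + star y"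
    and star_scaleC: "star (c *\<^sub>C x) = cnj c *\<^sub>C star x"
    and star_mult: "star (x * y) = star y * star x"
    and star_star [simp]: "star (star x) = x"

instantiation complex :: complex_star_algebra
begin
definition scaleC_complex :: "complex \<Rightarrow> complex \<Rightarrow> complex" where [simp]: "scaleC_complex = (*)"
definition star_complex :: "complex \<Rightarrow> complex" where [simp]: "star_complex = cnj"
instance by standard (auto simp: algebra_simps)
end


section \<open>The algebraic tensor product\<close>

text \<open>The tensor product is the quotient of the free vector space over the product set by the
  subspace spanned by the bilinearity relations.\<close>

instantiation poly_mapping :: (type, complex_vector) complex_vector
begin
lift_definition scaleC_poly_mapping :: "complex \<Rightarrow> ('a \<Rightarrow>\<^sub>0 'b) \<Rightarrow> 'a \<Rightarrow>\<^sub>0 'b"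
  is "\<lambda>c f k. c *\<^sub>C f k"
  by (rule finite_subset[rotated]) auto
instance
  by standard (transfer; auto simp: scaleC_add_right scaleC_add_left)+
end

lemma lookup_scaleC [simp]: "Poly_Mapping.lookup (c *\<^sub>C x) k = c *\<^sub>C Poly_Mapping.lookup x k"
  by transfer simp

abbreviation free_gen :: "'a \<Rightarrow> 'b \<Rightarrow> ('a \<times> 'b) \<Rightarrow>\<^sub>0 complex"
  where "free_gen a b \<equiv> Poly_Mapping.single (a, b) 1"

definition bilinear_relations :: "(('a::complex_vector \<times> 'b::complex_vector) \<Rightarrow>\<^sub>0 complex) set"
  where "bilinear_relations =
      {free_gen (a + a') b - free_gen a b - free_gen a' b | a a' b. True}
    \<union> {free_gen a (b + b') - free_gen a b - free_gen a b' | a b b'. True}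
    \<union> {free_gen (c *\<^sub>C a) b - c *\<^sub>C free_gen a b | c a b. True}
    \<union> {free_gen a (c *\<^sub>C b) - c *\<^sub>C free_gen a b | c a b. True}"

definition tensor_rel ::
    "(('a::complex_vector \<times> 'b::complex_vector) \<Rightarrow>\<^sub>0 complex) \<Rightarrow> (('a \<times> 'b) \<Rightarrow>\<^sub>0 complex) \<Rightarrow> bool"
  where "tensor_rel x y \<longleftrightarrow> x - y \<in> complex_vector.span bilinear_relations"

lemma equivp_tensor_rel:
  "equivp (tensor_rel :: (('a::complex_vector \<times> 'b::complex_vector) \<Rightarrow>\<^sub>0 complex) \<Rightarrow> _)"
proof (rule equivpI)
  show "reflp tensor_rel"
    by (auto simp: reflp_def tensor_rel_def complex_vector.span_zero)
  show "symp tensor_rel"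
    by (metis sympI tensor_rel_def complex_vector.span_neg minus_diff_eq)
  show "transp (tensor_rel :: (('a \<times> 'b) \<Rightarrow>\<^sub>0 complex) \<Rightarrow> _)"
  proof (rule transpI)
    fix x y z :: "('a \<times> 'b) \<Rightarrow>\<^sub>0 complex"
    assume "tensor_rel x y" "tensor_rel y z"
    then have "(x - y) + (y - z) \<in> complex_vector.span bilinear_relations"
      unfolding tensor_rel_def by (rule complex_vector.span_add)
    then show "tensor_rel x z" by (simp add: tensor_rel_def)
  qed
qed

quotient_type (overloaded) ('a, 'b) tensor =
    "('a::complex_vector \<times> 'b::complex_vector) \<Rightarrow>\<^sub>0 complex" / tensor_rel
  by (rule equivp_tensor_rel)

instantiation tensor :: (complex_vector, complex_vector) complex_vector
begin
lift_definition zero_tensor :: "('a, 'b) tensor" is 0 .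
lift_definition plus_tensor :: "('a, 'b) tensor \<Rightarrow> ('a, 'b) tensor \<Rightarrow> ('a, 'b) tensor" is "(+)"
  unfolding tensor_rel_def by (metis add_diff_add complex_vector.span_add)
lift_definition uminus_tensor :: "('a, 'b) tensor \<Rightarrow> ('a, 'b) tensor" is uminus
  unfolding tensor_rel_def by (metis minus_diff_minus complex_vector.span_neg)
lift_definition minus_tensor :: "('a, 'b) tensor \<Rightarrow> ('a, 'b) tensor \<Rightarrow> ('a, 'b) tensor" is "(-)"
proof -
  fix x x' y y' :: "('a \<times> 'b) \<Rightarrow>\<^sub>0 complex"
  assume "tensor_rel x x'" "tensor_rel y y'"
  moreover have "x - y - (x' - y') = (x - x') - (y - y')" by (simp add: algebra_simps)
  ultimately show "tensor_rel (x - y) (x' - y')"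
    unfolding tensor_rel_def by (metis complex_vector.span_diff)
qed
lift_definition scaleC_tensor :: "complex \<Rightarrow> ('a, 'b) tensor \<Rightarrow> ('a, 'b) tensor" is scaleC
  unfolding tensor_rel_def
  by (metis complex_vector.scale_right_diff_distrib complex_vector.span_scale)
instance
  by standard
    (transfer; simp add: tensor_rel_def complex_vector.span_zero algebra_simps
      scaleC_add_left scaleC_add_right)+
end

lift_definition tensor_elem :: "'a::complex_vector \<Rightarrow> 'b::complex_vector \<Rightarrow> ('a, 'b) tensor"
  (infixr \<open>\<otimes>\<close> 72) is free_gen .

text \<open>The parameter \<open>\<sigma>\<close> is the identity for linear extensions and complex conjugation for
  antilinear ones (needed for the involution on a tensor product).\<close>

definition semi_extend ::
    "(complex \<Rightarrow> complex) \<Rightarrow> ('a \<Rightarrow> 'b \<Rightarrow> 'c::complex_vector) \<Rightarrow> (('a \<times> 'b) \<Rightarrow>\<^sub>0 complex) \<Rightarrow> 'c"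
  where "semi_extend \<sigma> f x =
    (\<Sum>k\<in>Poly_Mapping.keys x. \<sigma> (Poly_Mapping.lookup x k) *\<^sub>C f (fst k) (snd k))"

definition semi_bilinear ::
    "(complex \<Rightarrow> complex) \<Rightarrow> ('a::complex_vector \<Rightarrow> 'b::complex_vector \<Rightarrow> 'c::complex_vector) \<Rightarrow> bool"
  where "semi_bilinear \<sigma> f \<longleftrightarrow>
      (\<forall>a a' b. f (a + a') b = f a b + f a' b) \<and> (\<forall>a b b'. f a (b + b') = f a b + f a b') \<and>
      (\<forall>c a b. f (c *\<^sub>C a) b = \<sigma> c *\<^sub>C f a b) \<and> (\<forall>c a b. f a (c *\<^sub>C b) = \<sigma> c *\<^sub>C f a b)"

definition semi_lift ::
    "(complex \<Rightarrow> complex) \<Rightarrow> ('a::complex_vector \<Rightarrow> 'b::complex_vector \<Rightarrow> 'c::complex_vector)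
      \<Rightarrow> ('a, 'b) tensor \<Rightarrow> 'c"
  where "semi_lift \<sigma> f t = semi_extend \<sigma> f (rep_tensor t)"

text \<open>Meaningful only for bilinear \<open>f\<close>; see \<open>tensor_lift_elem\<close> and \<open>clinear_tensor_lift\<close>.\<close>

definition tensor_lift ::
    "('a::complex_vector \<Rightarrow> 'b::complex_vector \<Rightarrow> 'c::complex_vector) \<Rightarrow> ('a, 'b) tensor \<Rightarrow> 'c"
  where "tensor_lift = semi_lift (\<lambda>c. c)"

definition tensor_map ::
    "('a::complex_vector \<Rightarrow> 'c::complex_vector) \<Rightarrow> ('b::complex_vector \<Rightarrow> 'd::complex_vector)
      \<Rightarrow> ('a, 'b) tensor \<Rightarrow> ('c, 'd) tensor"
  where "tensor_map f g = tensor_lift (\<lambda>a b. f a \<otimes> g b)"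

definition tensor_assoc ::
    "(('a::complex_vector, 'b::complex_vector) tensor, 'c::complex_vector) tensor
      \<Rightarrow> ('a, ('b, 'c) tensor) tensor"
  where "tensor_assoc = tensor_lift (\<lambda>t c. tensor_lift (\<lambda>a b. a \<otimes> (b \<otimes> c)) t)"

definition tensor_mult ::
    "('a::complex_star_algebra, 'b::complex_star_algebra) tensor \<Rightarrow> ('a, 'b) tensor \<Rightarrow> ('a, 'b) tensor"
  where "tensor_mult s t = tensor_lift (\<lambda>a b. tensor_lift (\<lambda>c d. (a * c) \<otimes> (b * d)) t) s"

definition tensor_star ::
    "('a::complex_star_algebra, 'b::complex_star_algebra) tensor \<Rightarrow> ('a, 'b) tensor"
  where "tensor_star = semi_lift cnj (\<lambda>a b. star a \<otimes> star b)"

lemma semi_extend_superset: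
  assumes "finite A" "Poly_Mapping.keys x \<subseteq> A" "\<sigma> 0 = 0"
  shows "semi_extend \<sigma> f x = (\<Sum>k\<in>A. \<sigma> (Poly_Mapping.lookup x k) *\<^sub>C f (fst k) (snd k))"
  unfolding semi_extend_def using assms
  by (intro sum.mono_neutral_left) (auto simp: in_keys_iff)

locale conjugation_or_id =
  fixes \<sigma> :: "complex \<Rightarrow> complex"
  assumes sigma_add: "\<sigma> (x + y) = \<sigma> x + \<sigma> y"
    and sigma_mult: "\<sigma> (x * y) = \<sigma> x * \<sigma> y"
    and sigma_one: "\<sigma> 1 = 1"
begin

lemma sigma_zero: "\<sigma> 0 = 0"
  using sigma_add[of 0 0] by simp

lemma semi_extend_add: "semi_extend \<sigma> f (x + y) = semi_extend \<sigma> f x + semi_extend \<sigma> f y"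
proof -
  let ?A = "Poly_Mapping.keys x \<union> Poly_Mapping.keys y"
  have "Poly_Mapping.keys (x + y) \<subseteq> ?A" by (rule Poly_Mapping.keys_add)
  then show ?thesis
    by (simp add: sigma_zero semi_extend_superset[of ?A] lookup_add sigma_add scaleC_add_left sum.distrib)
qed

lemma semi_extend_scaleC: "semi_extend \<sigma> f (c *\<^sub>C x) = \<sigma> c *\<^sub>C semi_extend \<sigma> f x"
proof -
  have "Poly_Mapping.keys (c *\<^sub>C x) \<subseteq> Poly_Mapping.keys x" by (auto simp: in_keys_iff)
  then show ?thesis
    by (simp add: semi_extend_superset[of "Poly_Mapping.keys x"] sigma_zero sigma_mult
        complex_vector.scale_sum_right)
qed

lemma semi_extend_diff: "semi_extend \<sigma> f (x - y) = semi_extend \<sigma> f x - semi_extend \<sigma> f y"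
  using semi_extend_add[of f "x - y" y] by simp

lemma semi_extend_gen: "semi_extend \<sigma> f (free_gen a b) = f a b"
  by (simp add: semi_extend_def sigma_one)

lemma semi_extend_cong:
  assumes "semi_bilinear \<sigma> f" "tensor_rel x y"
  shows "semi_extend \<sigma> f x = semi_extend \<sigma> f y"
proof -
  have "semi_extend \<sigma> f z = 0" if "z \<in> complex_vector.span bilinear_relations" for z
    using that
  proof (induction rule: complex_vector.span_induct_alt)
    case base
    show ?case by (simp add: semi_extend_def)
  next
    case (step c r z)
    have "semi_extend \<sigma> f r = 0"
      using step(1) assms(1) unfolding bilinear_relations_def semi_bilinear_def
      by (auto simp: semi_extend_diff semi_extend_scaleC semi_extend_add semi_extend_gen)
    with step show ?case by (simp add: semi_extend_add semi_extend_scaleC)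
  qed
  with assms(2) have "semi_extend \<sigma> f (x - y) = 0" by (simp add: tensor_rel_def)
  then show ?thesis by (simp add: semi_extend_diff)
qed

lemma semi_lift_abs: "semi_bilinear \<sigma> f \<Longrightarrow> semi_lift \<sigma> f (abs_tensor x) = semi_extend \<sigma> f x"
  unfolding semi_lift_def
  by (rule semi_extend_cong, assumption, rule Quotient3_rep_abs[OF Quotient3_tensor])
    (simp add: tensor_rel_def complex_vector.span_zero)

lemma semi_lift_elem: "semi_bilinear \<sigma> f \<Longrightarrow> semi_lift \<sigma> f (a \<otimes> b) = f a b"
  by (simp add: tensor_elem.abs_eq semi_lift_abs semi_extend_gen)

lemma semi_lift_add:
  assumes "semi_bilinear \<sigma> f"
  shows "semi_lift \<sigma> f (s + t) = semi_lift \<sigma> f s + semi_lift \<sigma> f t"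
  by (induct s rule: tensor.abs_induct; induct t rule: tensor.abs_induct)
    (simp add: assms plus_tensor.abs_eq semi_lift_abs semi_extend_add)

lemma semi_lift_scaleC:
  assumes "semi_bilinear \<sigma> f"
  shows "semi_lift \<sigma> f (c *\<^sub>C t) = \<sigma> c *\<^sub>C semi_lift \<sigma> f t"
  by (induct t rule: tensor.abs_induct)
    (simp add: assms scaleC_tensor.abs_eq semi_lift_abs semi_extend_scaleC)

end

interpretation sigma_id: conjugation_or_id "\<lambda>c. c" by (rule conjugation_or_id.intro) simp_all
interpretation sigma_cnj: conjugation_or_id cnj by (rule conjugation_or_id.intro) simp_all

abbreviation cbilinear ::
    "('a::complex_vector \<Rightarrow> 'b::complex_vector \<Rightarrow> 'c::complex_vector) \<Rightarrow> bool"
  where "cbilinear \<equiv> semi_bilinear (\<lambda>c. c)"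

lemma tensor_lift_elem: "cbilinear f \<Longrightarrow> tensor_lift f (a \<otimes> b) = f a b"
  unfolding tensor_lift_def by (rule sigma_id.semi_lift_elem[of f a b])

lemma clinear_tensor_lift: "cbilinear f \<Longrightarrow> clinear (tensor_lift f)"
  unfolding clinear_iff tensor_lift_def
  by (intro conjI allI) (rule sigma_id.semi_lift_add sigma_id.semi_lift_scaleC, assumption)+

lemma cbilinear_tensor_elem: "cbilinear (\<otimes>)"
proof -
  have rel: "tensor_rel x y" if "x - y \<in> bilinear_relations"
    for x y :: "('a \<times> 'b) \<Rightarrow>\<^sub>0 complex"
    using that by (simp add: tensor_rel_def complex_vector.span_base)
  have "tensor_rel (free_gen (a + a') b) (free_gen a b + free_gen a' b)"
    "tensor_rel (free_gen a (b + b')) (free_gen a b + free_gen a b')"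
    "tensor_rel (free_gen (c *\<^sub>C a) b) (c *\<^sub>C free_gen a b)"
    "tensor_rel (free_gen a (c *\<^sub>C b)) (c *\<^sub>C free_gen a b)" for a a' :: 'a and b b' :: 'b and c
    by (rule rel, unfold bilinear_relations_def diff_diff_eq[symmetric], blast)+
  then show ?thesis
    by (simp add: semi_bilinear_def tensor_elem.abs_eq plus_tensor.abs_eq scaleC_tensor.abs_eq
        tensor.abs_eq_iff)
qed

lemma
  fixes a a' :: "'a::complex_vector" and b b' :: "'b::complex_vector"
  shows tensor_add_left: "(a + a') \<otimes> b = a \<otimes> b + a' \<otimes> b"
    and tensor_add_right: "a \<otimes> (b + b') = a \<otimes> b + a \<otimes> b'"
    and tensor_scaleC_left: "(c *\<^sub>C a) \<otimes> b = c *\<^sub>C (a \<otimes> b)"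
    and tensor_scaleC_right: "a \<otimes> (c *\<^sub>C b) = c *\<^sub>C (a \<otimes> b)"
  using cbilinear_tensor_elem[where 'a='a and 'b='b] by (auto simp: semi_bilinear_def)

lemmas tensor_elem_simps =
  tensor_add_left tensor_add_right tensor_scaleC_left tensor_scaleC_right

lemma tensor_induct [case_names elem add]:
  assumes elem: "\<And>a b. P (a \<otimes> b)" and add: "\<And>s t. P s \<Longrightarrow> P t \<Longrightarrow> P (s + t)"
  shows "P t"
proof -
  have "P (abs_tensor x)" for x
  proof (induction x rule: update_induct)
    case const
    have "abs_tensor 0 = (0 :: ('a, 'b) tensor)" by (simp add: zero_tensor.abs_eq)
    also have "\<dots> = 0 \<otimes> 0" using tensor_scaleC_left[of 0 0 0] by simp
    finally show ?case using elem by metis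
  next
    case (update f k v)
    have "Poly_Mapping.update k v f = f + v *\<^sub>C free_gen (fst k) (snd k)"
      using update(1)
      by (auto intro!: poly_mapping_eqI simp: lookup_single when_def lookup_add lookup_update
          in_keys_iff)
    then have "abs_tensor (Poly_Mapping.update k v f) = abs_tensor f + (v *\<^sub>C fst k) \<otimes> snd k"
      by (simp only: plus_tensor.abs_eq[symmetric] scaleC_tensor.abs_eq[symmetric]
          tensor_elem.abs_eq[symmetric] tensor_scaleC_left)
    then show ?case using add[OF update(3) elem] by simp
  qed
  then show ?thesis by (induct t rule: tensor.abs_induct)
qed

lemma tensor_map_elem: "clinear f \<Longrightarrow> clinear g \<Longrightarrow> tensor_map f g (a \<otimes> b) = f a \<otimes> g b"
  unfolding tensor_map_def
  by (subst tensor_lift_elem) (auto simp: semi_bilinear_def clinear_iff tensor_elem_simps)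

lemma tensor_mult_elem: "tensor_mult (a \<otimes> b) (c \<otimes> d) = (a * c) \<otimes> (b * d)"
proof -
  have 1: "cbilinear (\<lambda>c d. (a * c) \<otimes> (b * d))" for a :: 'a and b :: 'b
    by (simp add: semi_bilinear_def distrib_left mult_scaleC_right tensor_elem_simps)
  have 2: "cbilinear (\<lambda>a b. tensor_lift (\<lambda>c d. (a * c) \<otimes> (b * d)) (c \<otimes> d))"
    unfolding tensor_lift_elem[OF 1]
    by (simp add: semi_bilinear_def distrib_right mult_scaleC_left tensor_elem_simps)
  show ?thesis
    unfolding tensor_mult_def by (subst tensor_lift_elem[OF 2]) (rule tensor_lift_elem[OF 1])
qed

lemma tensor_star_elem: "tensor_star (a \<otimes> b) = star a \<otimes> star b"
  unfolding tensor_star_def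
  by (subst sigma_cnj.semi_lift_elem)
    (auto simp: semi_bilinear_def star_add star_scaleC tensor_elem_simps)

lemma tensor_assoc_elem:
  fixes a :: "'a::complex_vector" and b :: "'b::complex_vector" and c :: "'c::complex_vector"
  shows "tensor_assoc ((a \<otimes> b) \<otimes> c) = a \<otimes> (b \<otimes> c)"
proof -
  have 1: "cbilinear (\<lambda>(a :: 'a) (b :: 'b). a \<otimes> (b \<otimes> c))" for c :: 'c
    by (simp add: semi_bilinear_def tensor_elem_simps)
  have lin: "tensor_lift (\<lambda>a b. a \<otimes> (b \<otimes> c)) (s + t) =
        tensor_lift (\<lambda>a b. a \<otimes> (b \<otimes> c)) s + tensor_lift (\<lambda>a b. a \<otimes> (b \<otimes> c)) t"
      "tensor_lift (\<lambda>a b. a \<otimes> (b \<otimes> c)) (z *\<^sub>C s) = z *\<^sub>C tensor_lift (\<lambda>a b. a \<otimes> (b \<otimes> c)) s"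
    for s t :: "('a, 'b) tensor" and c :: 'c and z
    using clinear_tensor_lift[OF 1[of c]] by (simp_all add: clinear_iff)
  have lin_add: "tensor_lift (\<lambda>a b. a \<otimes> (b \<otimes> (c + c'))) t =
        tensor_lift (\<lambda>a b. a \<otimes> (b \<otimes> c)) t + tensor_lift (\<lambda>a b. a \<otimes> (b \<otimes> c')) t"
    for t :: "('a, 'b) tensor" and c c' :: 'c
  proof (induction t rule: tensor_induct)
    case (elem a b)
    show ?case unfolding tensor_lift_elem[OF 1] by (simp add: tensor_elem_simps)
  next
    case (add s t)
    show ?case unfolding lin(1) add by (simp add: algebra_simps)
  qed
  have lin_scaleC: "tensor_lift (\<lambda>a b. a \<otimes> (b \<otimes> (z *\<^sub>C c))) t =
      z *\<^sub>C tensor_lift (\<lambda>a b. a \<otimes> (b \<otimes> c)) t"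
    for t :: "('a, 'b) tensor" and c :: 'c and z
  proof (induction t rule: tensor_induct)
    case (elem a b)
    show ?case unfolding tensor_lift_elem[OF 1] by (simp add: tensor_elem_simps)
  next
    case (add s t)
    show ?case unfolding lin(1) add by (simp add: scaleC_add_right)
  qed
  have 2: "cbilinear (\<lambda>(t :: ('a, 'b) tensor) (c :: 'c). tensor_lift (\<lambda>a b. a \<otimes> (b \<otimes> c)) t)"
    unfolding semi_bilinear_def by (intro conjI allI lin lin_add lin_scaleC)
  show ?thesis
    unfolding tensor_assoc_def by (subst tensor_lift_elem[OF 2]) (rule tensor_lift_elem[OF 1])
qed


section \<open>Hopf *-algebras and admissible bijections\<close>

locale hopf_star_algebra =
  fixes \<Delta> :: "'a::complex_star_algebra \<Rightarrow> ('a, 'a) tensor"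
    and \<epsilon> :: "'a \<Rightarrow> complex"
    and S :: "'a \<Rightarrow> 'a"
  assumes comult_linear: "clinear \<Delta>"
    and comult_mult: "\<Delta> (a * b) = tensor_mult (\<Delta> a) (\<Delta> b)"
    and comult_one: "\<Delta> 1 = 1 \<otimes> 1"
    and comult_star: "\<Delta> (star a) = tensor_star (\<Delta> a)"
    and counit_linear: "clinear \<epsilon>"
    and counit_mult: "\<epsilon> (a * b) = \<epsilon> a * \<epsilon> b"
    and counit_one: "\<epsilon> 1 = 1"
    and counit_star: "\<epsilon> (star a) = cnj (\<epsilon> a)"
    and coassociative: "tensor_assoc (tensor_map \<Delta> id (\<Delta> a)) = tensor_map id \<Delta> (\<Delta> a)"
    and counit_left: "tensor_lift (\<lambda>x y. \<epsilon> x *\<^sub>C y) (\<Delta> a) = a"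
    and counit_right: "tensor_lift (\<lambda>x y. \<epsilon> y *\<^sub>C x) (\<Delta> a) = a"
    and antipode_linear: "clinear S"
    and antipode_left: "tensor_lift (\<lambda>x y. S x * y) (\<Delta> a) = \<epsilon> a *\<^sub>C 1"
    and antipode_right: "tensor_lift (\<lambda>x y. x * S y) (\<Delta> a) = \<epsilon> a *\<^sub>C 1"

definition algebra_hom :: "('a::complex_star_algebra \<Rightarrow> 'b::complex_star_algebra) \<Rightarrow> bool"
  where "algebra_hom f \<longleftrightarrow> clinear f \<and> (\<forall>a b. f (a * b) = f a * f b) \<and> f 1 = 1"

definition admissible_bijection ::
    "('a::complex_star_algebra \<Rightarrow> ('a, 'a) tensor) \<Rightarrow> ('a \<Rightarrow> 'a) \<Rightarrow> bool"
  where "admissible_bijection \<Delta> \<alpha> \<longleftrightarrow>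
      algebra_hom \<alpha> \<and>
      \<alpha> \<circ> star \<circ> \<alpha> \<circ> star = id \<and>
      tensor_map \<alpha> \<alpha> \<circ> \<Delta> = \<Delta> \<circ> \<alpha> \<and>
      bij (\<lambda>a. a + \<alpha> a) \<and>
      bij (\<lambda>t. tensor_map id id t + tensor_map \<alpha> \<alpha> t)"


section \<open>Pre-Hilbert spaces and their completions\<close>

text \<open>Pre-Hilbert spaces of all sizes have to be compared inside one statement, so they are
  structures carried by subsets of a type \<open>'h\<close> rather than types of a class. The type \<open>'h\<close> plays
  the role of a universe: it may be arbitrarily large, and it must be at least as large as the
  algebra for the pre-Hilbert space built from a generating functional to fit into it.\<close>

record 'h prehilbert =
  carrier :: "'h set"
  vadd :: "'h \<Rightarrow> 'h \<Rightarrow> 'h"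
  vzero :: 'h
  vscale :: "complex \<Rightarrow> 'h \<Rightarrow> 'h"
  ip :: "'h \<Rightarrow> 'h \<Rightarrow> complex"

locale prehilbert_space =
  fixes D :: "'h prehilbert"
  assumes vadd_closed: "x \<in> carrier D \<Longrightarrow> y \<in> carrier D \<Longrightarrow> vadd D x y \<in> carrier D"
    and vzero_closed: "vzero D \<in> carrier D"
    and vscale_closed: "x \<in> carrier D \<Longrightarrow> vscale D c x \<in> carrier D"
    and vadd_assoc: "x \<in> carrier D \<Longrightarrow> y \<in> carrier D \<Longrightarrow> z \<in> carrier D \<Longrightarrow>
        vadd D (vadd D x y) z = vadd D x (vadd D y z)"
    and vadd_commute: "x \<in> carrier D \<Longrightarrow> y \<in> carrier D \<Longrightarrow> vadd D x y = vadd D y x"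
    and vadd_zero: "x \<in> carrier D \<Longrightarrow> vadd D (vzero D) x = x"
    and vadd_inverse: "x \<in> carrier D \<Longrightarrow> vadd D x (vscale D (-1) x) = vzero D"
    and vscale_vadd: "x \<in> carrier D \<Longrightarrow> y \<in> carrier D \<Longrightarrow>
        vscale D c (vadd D x y) = vadd D (vscale D c x) (vscale D c y)"
    and add_vscale: "x \<in> carrier D \<Longrightarrow> vscale D (c + d) x = vadd D (vscale D c x) (vscale D d x)"
    and vscale_vscale: "x \<in> carrier D \<Longrightarrow> vscale D c (vscale D d x) = vscale D (c * d) x"
    and vscale_one: "x \<in> carrier D \<Longrightarrow> vscale D 1 x = x"
    and ip_vadd: "x \<in> carrier D \<Longrightarrow> y \<in> carrier D \<Longrightarrow> z \<in> carrier D \<Longrightarrow>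
        ip D x (vadd D y z) = ip D x y + ip D x z"
    and ip_vscale: "x \<in> carrier D \<Longrightarrow> y \<in> carrier D \<Longrightarrow> ip D x (vscale D c y) = c * ip D x y"
    and ip_cnj: "x \<in> carrier D \<Longrightarrow> y \<in> carrier D \<Longrightarrow> ip D y x = cnj (ip D x y)"
    and ip_nonneg: "x \<in> carrier D \<Longrightarrow> ip D x x \<in> \<real>\<^sub>\<ge>\<^sub>0"
    and ip_definite: "x \<in> carrier D \<Longrightarrow> ip D x x = 0 \<Longrightarrow> x = vzero D"

definition vdist :: "'h prehilbert \<Rightarrow> 'h \<Rightarrow> 'h \<Rightarrow> real"
  where "vdist D x y = (let v = vadd D x (vscale D (-1) y) in sqrt (Re (ip D v v)))"

definition dense_in :: "'h prehilbert \<Rightarrow> 'h set \<Rightarrow> bool"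
  where "dense_in D M \<longleftrightarrow> M \<subseteq> carrier D \<and> (\<forall>x\<in>carrier D. \<forall>e>0. \<exists>y\<in>M. vdist D x y < e)"

definition linear_between ::
    "'h prehilbert \<Rightarrow> 'k prehilbert \<Rightarrow> ('h \<Rightarrow> 'k) \<Rightarrow> bool"
  where "linear_between D E T \<longleftrightarrow>
      T ` carrier D \<subseteq> carrier E \<and>
      (\<forall>x\<in>carrier D. \<forall>y\<in>carrier D. T (vadd D x y) = vadd E (T x) (T y)) \<and>
      (\<forall>c. \<forall>x\<in>carrier D. T (vscale D c x) = vscale E c (T x))"

definition unitary_between :: "'h prehilbert \<Rightarrow> 'k prehilbert \<Rightarrow> ('h \<Rightarrow> 'k) \<Rightarrow> bool"
  where "unitary_between D E U \<longleftrightarrow>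
      linear_between D E U \<and> bij_betw U (carrier D) (carrier E) \<and>
      (\<forall>x\<in>carrier D. \<forall>y\<in>carrier D. ip E (U x) (U y) = ip D x y)"

text \<open>The Hilbert space completion: Cauchy sequences modulo null sequences.\<close>

definition cauchy_seqs :: "'h prehilbert \<Rightarrow> (nat \<Rightarrow> 'h) set"
  where "cauchy_seqs D = {X. range X \<subseteq> carrier D \<and>
      (\<forall>e>0. \<exists>N. \<forall>m\<ge>N. \<forall>n\<ge>N. vdist D (X m) (X n) < e)}"

definition null_rel :: "'h prehilbert \<Rightarrow> ((nat \<Rightarrow> 'h) \<times> (nat \<Rightarrow> 'h)) set"
  where "null_rel D = {(X, Y) \<in> cauchy_seqs D \<times> cauchy_seqs D.
      (\<lambda>n. vdist D (X n) (Y n)) \<longlonglongrightarrow> 0}"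

definition completion :: "'h prehilbert \<Rightarrow> (nat \<Rightarrow> 'h) set prehilbert"
  where "completion D = \<lparr>
      carrier = cauchy_seqs D // null_rel D,
      vadd = (\<lambda>P Q. \<Union>X\<in>P. \<Union>Y\<in>Q. null_rel D `` {\<lambda>n. vadd D (X n) (Y n)}),
      vzero = null_rel D `` {\<lambda>n. vzero D},
      vscale = (\<lambda>c P. \<Union>X\<in>P. null_rel D `` {\<lambda>n. vscale D c (X n)}),
      ip = (\<lambda>P Q. THE z. \<exists>X\<in>P. \<exists>Y\<in>Q. (\<lambda>n. ip D (X n) (Y n)) \<longlonglongrightarrow> z)\<rparr>"

definition to_completion :: "'h prehilbert \<Rightarrow> 'h \<Rightarrow> (nat \<Rightarrow> 'h) set"
  where "to_completion D x = null_rel D `` {\<lambda>n. x}"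


section \<open>Representations, cocycles and generating functionals\<close>

definition is_adjoint :: "'h prehilbert \<Rightarrow> ('h \<Rightarrow> 'h) \<Rightarrow> ('h \<Rightarrow> 'h) \<Rightarrow> bool"
  where "is_adjoint D T T' \<longleftrightarrow> (\<forall>x\<in>carrier D. \<forall>y\<in>carrier D. ip D (T' x) y = ip D x (T y))"

definition adjointable_ops :: "'h prehilbert \<Rightarrow> ('h \<Rightarrow> 'h) set"
  where "adjointable_ops D =
      {T. linear_between D D T \<and> (\<exists>T'. linear_between D D T' \<and> is_adjoint D T T')}"

text \<open>Operators are identified when they agree on the carrier. In a pre-Hilbert space adjoints are
  unique in this sense, so the last clause says that \<open>\<pi> (star a)\<close> is the adjoint of \<open>\<pi> a\<close>.\<close>

definition representation ::
    "'h prehilbert \<Rightarrow> ('a::complex_star_algebra \<Rightarrow> 'h \<Rightarrow> 'h) \<Rightarrow> bool"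
  where "representation D \<pi> \<longleftrightarrow>
      (\<forall>a. \<pi> a \<in> adjointable_ops D) \<and>
      (\<forall>a b. \<forall>x\<in>carrier D. \<pi> (a + b) x = vadd D (\<pi> a x) (\<pi> b x)) \<and>
      (\<forall>c a. \<forall>x\<in>carrier D. \<pi> (c *\<^sub>C a) x = vscale D c (\<pi> a x)) \<and>
      (\<forall>a b. \<forall>x\<in>carrier D. \<pi> (a * b) x = \<pi> a (\<pi> b x)) \<and>
      (\<forall>x\<in>carrier D. \<pi> 1 x = x) \<and>
      (\<forall>a. is_adjoint D (\<pi> a) (\<pi> (star a)))"

definition cocycle ::
    "('a::complex_star_algebra \<Rightarrow> complex) \<Rightarrow> 'h prehilbert \<Rightarrow> ('a \<Rightarrow> 'h) \<Rightarrow> bool"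
  where "cocycle \<epsilon> D \<eta> \<longleftrightarrow>
      prehilbert_space D \<and>
      (\<forall>a. \<eta> a \<in> carrier D) \<and>
      (\<forall>a b. \<eta> (a + b) = vadd D (\<eta> a) (\<eta> b)) \<and>
      (\<forall>c a. \<eta> (c *\<^sub>C a) = vscale D c (\<eta> a)) \<and>
      (\<exists>\<pi>. representation D \<pi> \<and>
        (\<forall>a b. \<eta> (a * b) = vadd D (\<pi> a (\<eta> b)) (vscale D (\<epsilon> b) (\<eta> a)))) \<and>
      dense_in D (range \<eta>)"

text \<open>The parameter \<open>s\<close> stands for \<open>S \<circ> \<alpha>\<close>.\<close>

definition real_cocycles ::
    "('a::complex_star_algebra \<Rightarrow> complex) \<Rightarrow> ('a \<Rightarrow> 'a) \<Rightarrow> ('h prehilbert \<times> ('a \<Rightarrow> 'h)) set"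
  where "real_cocycles \<epsilon> s = {(D, \<eta>). cocycle \<epsilon> D \<eta> \<and>
      (\<forall>a b. ip D (\<eta> a) (\<eta> b) = ip D (\<eta> (star (s b))) (\<eta> (s (star a))))}"

definition unitarily_equivalent ::
    "'h prehilbert \<times> ('a \<Rightarrow> 'h) \<Rightarrow> 'k prehilbert \<times> ('a \<Rightarrow> 'k) \<Rightarrow> bool"
  where "unitarily_equivalent = (\<lambda>(D1, \<eta>1) (D2, \<eta>2).
      \<exists>U. unitary_between (completion D1) (completion D2) U \<and>
        (\<forall>a. to_completion D2 (\<eta>2 a) = U (to_completion D1 (\<eta>1 a))))"

definition real_cocycle_classes ::
    "('a::complex_star_algebra \<Rightarrow> complex) \<Rightarrow> ('a \<Rightarrow> 'a) \<Rightarrow> ('h prehilbert \<times> ('a \<Rightarrow> 'h)) set set"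
  where "real_cocycle_classes \<epsilon> s = real_cocycles \<epsilon> s //
      {(p, q) \<in> real_cocycles \<epsilon> s \<times> real_cocycles \<epsilon> s. unitarily_equivalent p q}"

definition generating_functional ::
    "('a::complex_star_algebra \<Rightarrow> complex) \<Rightarrow> ('a \<Rightarrow> complex) \<Rightarrow> bool"
  where "generating_functional \<epsilon> L \<longleftrightarrow>
      clinear L \<and>
      (\<forall>a. \<epsilon> a = 0 \<longrightarrow> L (star a * a) \<in> \<real>\<^sub>\<ge>\<^sub>0) \<and>
      (\<forall>b. L (star b) = cnj (L b)) \<and>
      L 1 = 0"

definition invariant_generating_functionals ::
    "('a::complex_star_algebra \<Rightarrow> complex) \<Rightarrow> ('a \<Rightarrow> 'a) \<Rightarrow> ('a \<Rightarrow> complex) set"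
  where "invariant_generating_functionals \<epsilon> s = {L. generating_functional \<epsilon> L \<and> L \<circ> s = L}"

definition yields_coboundary ::
    "('a::complex_star_algebra \<Rightarrow> complex) \<Rightarrow> 'h prehilbert \<Rightarrow> ('a \<Rightarrow> 'h) \<Rightarrow> ('a \<Rightarrow> complex) \<Rightarrow> bool"
  where "yields_coboundary \<epsilon> D \<eta> L \<longleftrightarrow>
      (\<forall>a b. L (a * b) = \<epsilon> a * L b + L a * \<epsilon> b + ip D (\<eta> (star a)) (\<eta> b))"

end

theory Submission
  imports Defs
begin

text \<open>A functional \<open>L\<close> gives the positive form
  \<open>L((a - \<epsilon>(a))\<^sup>* (b - \<epsilon>(b)))\<close>, whose GNS quotient carries the cocycle; two cocycles are
  unitarily equivalent iff they induce the same form, so the task is to show that each form of an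
  \<open>\<alpha>\<close>-real cocycle comes from exactly one \<open>L\<close>.

  Write \<open>\<psi>(a, b) = \<langle>\<eta>(a\<^sup>*), \<eta>(b)\<rangle>\<close> and \<open>H(a) = - \<Sum> \<psi>(a\<^sub>1, S a\<^sub>2)\<close> in Sweedler notation. Applying the
  coboundary identity to \<open>\<Sum> a\<^sub>1 S(a\<^sub>2) = \<epsilon>(a)\<close> forces \<open>L + L \<circ> S = H\<close>, and with
  \<open>S\<^sub>\<alpha>\<close>-invariance \<open>L \<circ> (id + \<alpha>) = H \<circ> \<alpha>\<close>. Since \<open>id + \<alpha>\<close> is bijective, this proves uniqueness and
  defines \<open>L\<close>. The 2-cocycle identity for \<open>\<psi>\<close> shows that the coboundary of \<open>H\<close> is
  \<open>\<psi>(a, b) + \<psi>(S b, S a)\<close>; by \<open>\<alpha>\<close>-reality the coboundary of \<open>L\<close> minus \<open>\<psi>\<close> therefore vanishes on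
  the range of \<open>id \<otimes> id + \<alpha> \<otimes> \<alpha>\<close>, which is everything. Hermitian symmetry of \<open>L\<close> follows from
  uniqueness.\<close>

section \<open>Linear maps and Sweedler sums\<close>

lemma clinearI:
  "(\<And>x y. f (x + y) = f x + f y) \<Longrightarrow> (\<And>c x. f (c *\<^sub>C x) = c *\<^sub>C f x) \<Longrightarrow> clinear f"
  by (simp add: clinear_iff)

lemma clinear_add: "clinear f \<Longrightarrow> f (x + y) = f x + f y"
  and clinear_scaleC: "clinear f \<Longrightarrow> f (c *\<^sub>C x) = c *\<^sub>C f x"
  by (auto simp: clinear_iff)

lemma clinear_zero: "clinear f \<Longrightarrow> f 0 = 0"
  using clinear_add[of f 0 0] by simp

lemma clinear_diff: "clinear f \<Longrightarrow> f (x - y) = f x - f y"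
  using clinear_add[of f "x - y" y] by simp

lemma clinear_sum: "clinear f \<Longrightarrow> f (\<Sum>i\<in>A. g i) = (\<Sum>i\<in>A. f (g i))"
  by (induction A rule: infinite_finite_induct) (auto simp: clinear_zero clinear_add)

lemma cbilinear_iff: "cbilinear f \<longleftrightarrow> (\<forall>b. clinear (\<lambda>a. f a b)) \<and> (\<forall>a. clinear (f a))"
  by (auto simp: semi_bilinear_def clinear_iff)

lemma cbilinearI:
  "(\<And>b. clinear (\<lambda>a. f a b)) \<Longrightarrow> (\<And>a. clinear (f a)) \<Longrightarrow> cbilinear f"
  by (auto simp: cbilinear_iff)

lemma clinear_ident: "clinear (\<lambda>x. x)"
  by (simp add: clinear_iff)

lemma clinear_mult_left: "clinear f \<Longrightarrow> clinear (\<lambda>x. f x * (y::'b::complex_star_algebra))"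
  by (simp add: clinear_iff distrib_right mult_scaleC_left)

lemma clinear_mult_right: "clinear f \<Longrightarrow> clinear (\<lambda>x. (y::'b::complex_star_algebra) * f x)"
  by (simp add: clinear_iff distrib_left mult_scaleC_right)

lemma clinear_scale_left: "clinear f \<Longrightarrow> clinear (\<lambda>x. f x *\<^sub>C y)"
  unfolding clinear_iff by (simp add: scaleC_add_left)

lemma clinear_scale_right: "clinear f \<Longrightarrow> clinear (\<lambda>x. c *\<^sub>C f x)"
  by (simp add: clinear_iff scaleC_add_right mult.commute)

lemma clinear_compose_fun: "clinear g \<Longrightarrow> clinear f \<Longrightarrow> clinear (\<lambda>x. g (f x))"
  by (simp add: clinear_iff)

lemma clinear_plus: "clinear f \<Longrightarrow> clinear g \<Longrightarrow> clinear (\<lambda>x. f x + g x)"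
  by (simp add: clinear_iff scaleC_add_right algebra_simps)

lemma clinear_minus: "clinear f \<Longrightarrow> clinear g \<Longrightarrow> clinear (\<lambda>x. f x - g x)"
  by (simp add: clinear_iff complex_vector.scale_right_diff_distrib algebra_simps)

lemma clinear_sum_fun: "(\<And>i. i \<in> A \<Longrightarrow> clinear (f i)) \<Longrightarrow> clinear (\<lambda>x. \<Sum>i\<in>A. f i x)"
  by (simp add: clinear_iff sum.distrib complex_vector.scale_sum_right)

section \<open>Maps out of the tensor product\<close>

lemma tensor_lift_sum:
  "cbilinear f \<Longrightarrow> tensor_lift f (\<Sum>i\<in>A. x i \<otimes> y i) = (\<Sum>i\<in>A. f (x i) (y i))"
  by (simp add: clinear_sum[OF clinear_tensor_lift] tensor_lift_elem)

text \<open>Nested lifts, such as those in \<open>tensor_assoc\<close> and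
  \<open>tensor_mult\<close>, need linearity in a parameter. On elementary tensors this is the first
  hypothesis, and \<open>tensor_induct\<close> carries it to sums.\<close>

lemma clinear_tensor_lift_param:
  assumes "\<And>y z. clinear (\<lambda>x. F x y z)" "\<And>x. cbilinear (F x)"
  shows "clinear (\<lambda>x. tensor_lift (F x) t)"
proof (induction t rule: tensor_induct)
  case (elem a b)
  then show ?case using assms by (simp add: tensor_lift_elem)
next
  case (add s t)
  then show ?case
    using assms by (simp add: clinear_add[OF clinear_tensor_lift] clinear_plus)
qed

lemma clinear_tensor_map: "clinear f \<Longrightarrow> clinear g \<Longrightarrow> clinear (tensor_map f g)"
  unfolding tensor_map_def
  by (rule clinear_tensor_lift) (simp add: semi_bilinear_def clinear_iff tensor_elem_simps)

lemma clinear_id: "clinear id"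
  by (simp add: clinear_iff)

lemma tensor_map_id_id: "tensor_map id id t = t"
proof (induction t rule: tensor_induct)
  case (elem a b)
  show ?case by (simp add: tensor_map_elem clinear_ident)
next
  case (add s t)
  then show ?case by (simp add: clinear_add[OF clinear_tensor_map[OF clinear_ident clinear_ident]])
qed

text \<open>The source of the Sweedler legs. With lists, concatenation realises addition and
  repeated summands are kept.\<close>

lemma tensor_list_repr: "\<exists>xs. t = (\<Sum>p\<leftarrow>xs. fst p \<otimes> snd p)"
proof (induction t rule: tensor_induct)
  case (elem a b)
  have "a \<otimes> b = (\<Sum>p\<leftarrow>[(a, b)]. fst p \<otimes> snd p)" by simp
  then show ?case by blast
next
  case (add s t)
  then obtain xs ys where "s = (\<Sum>p\<leftarrow>xs. fst p \<otimes> snd p)" "t = (\<Sum>p\<leftarrow>ys. fst p \<otimes> snd p)"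
    by blast
  then have "s + t = (\<Sum>p\<leftarrow>xs @ ys. fst p \<otimes> snd p)" by simp
  then show ?case by blast
qed

section \<open>Sweedler calculus\<close>

context hopf_star_algebra
begin

text \<open>The Sweedler sum is taken over a chosen representation of
  \<open>\<Delta> a\<close>. For bilinear \<open>f\<close> the choice does not matter; defining it for all \<open>f\<close> makes iterated
  sums commute without side conditions.\<close>

definition legs :: "'a \<Rightarrow> ('a \<times> 'a) list"
  where "legs a = (SOME xs. \<Delta> a = (\<Sum>p\<leftarrow>xs. fst p \<otimes> snd p))"

definition sweedler :: "('a \<Rightarrow> 'a \<Rightarrow> 'c::comm_monoid_add) \<Rightarrow> 'a \<Rightarrow> 'c"
  where "sweedler f a = (\<Sum>i<length (legs a). f (fst (legs a ! i)) (snd (legs a ! i)))"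

lemma comult_sweedler: "\<Delta> a = sweedler (\<otimes>) a"
proof -
  have "\<Delta> a = (\<Sum>p\<leftarrow>legs a. fst p \<otimes> snd p)"
    unfolding legs_def by (rule someI_ex) (rule tensor_list_repr)
  also have "\<dots> = sweedler (\<otimes>) a"
    unfolding sweedler_def by (simp add: sum_list_sum_nth atLeast0LessThan)
  finally show ?thesis .
qed

lemma tensor_lift_comult: "cbilinear f \<Longrightarrow> tensor_lift f (\<Delta> a) = sweedler f a"
  by (simp add: comult_sweedler) (simp add: sweedler_def tensor_lift_sum)

lemma clinear_sweedler: "cbilinear f \<Longrightarrow> clinear (sweedler f)"
  using clinear_compose_fun[OF clinear_tensor_lift comult_linear, of f]
  by (simp add: tensor_lift_comult)

text \<open>The legs of \<open>a\<close> stay fixed, so this is a finite sum of functions linear in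
  the parameter.\<close>

lemma clinear_sweedler_param: "(\<And>u v. clinear (\<lambda>x. F x u v)) \<Longrightarrow> clinear (\<lambda>x. sweedler (F x) a)"
  unfolding sweedler_def by (rule clinear_sum_fun)

lemma sweedler_clinear: "clinear g \<Longrightarrow> g (sweedler f a) = sweedler (\<lambda>x y. g (f x y)) a"
  by (simp add: sweedler_def clinear_sum)

lemma sweedler_swap:
  "sweedler (\<lambda>x y. sweedler (\<lambda>u v. F x y u v) b) a =
    sweedler (\<lambda>u v. sweedler (\<lambda>x y. F x y u v) a) b"
  unfolding sweedler_def by (rule sum.swap)

lemma sweedler_add: "sweedler (\<lambda>x y. f x y + g x y) a = sweedler f a + sweedler g a"
  by (simp add: sweedler_def sum.distrib)

lemma sweedler_diff:
  fixes f g :: "'a \<Rightarrow> 'a \<Rightarrow> 'c::ab_group_add"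
  shows "sweedler (\<lambda>x y. f x y - g x y) a = sweedler f a - sweedler g a"
  by (simp add: sweedler_def sum_subtractf)

lemma sweedler_mult_left:
  fixes c :: "'c::semiring_0"
  shows "c * sweedler f a = sweedler (\<lambda>x y. c * f x y) a"
  by (simp add: sweedler_def sum_distrib_left)

lemma sweedler_mult_right:
  fixes c :: "'c::semiring_0"
  shows "sweedler f a * c = sweedler (\<lambda>x y. f x y * c) a"
  by (simp add: sweedler_def sum_distrib_right)

lemma sweedler_scaleC:
  fixes f :: "'a \<Rightarrow> 'a \<Rightarrow> 'c::complex_vector"
  shows "c *\<^sub>C sweedler f a = sweedler (\<lambda>x y. c *\<^sub>C f x y) a"
  by (simp add: sweedler_def complex_vector.scale_sum_right)

text \<open>The two sides are the values of the trilinear lift \<open>T\<close> of \<open>F\<close>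
  at the two sides of the axiom \<open>coassociative\<close>.\<close>

lemma sweedler_coassoc:
  assumes 1: "\<And>y z. clinear (\<lambda>x. F x y z)" and 2: "\<And>x z. clinear (\<lambda>y. F x y z)"
    and 3: "\<And>x y. clinear (F x y)"
  shows "sweedler (\<lambda>x y. sweedler (\<lambda>u v. F u v y) x) a = sweedler (\<lambda>x y. sweedler (F x) y) a"
proof -
  define T where "T = tensor_lift (\<lambda>x. tensor_lift (F x))"
  have F: "cbilinear (F x)" for x using 2 3 by (rule cbilinearI)
  have T: "cbilinear (\<lambda>x. tensor_lift (F x))"
    by (intro cbilinearI clinear_tensor_lift_param clinear_tensor_lift 1 F)
  have lT: "clinear T" unfolding T_def by (rule clinear_tensor_lift[OF T])
  have lA: "clinear (tensor_assoc :: (('a,'a) tensor, 'a) tensor \<Rightarrow> _)"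
    unfolding tensor_assoc_def
    by (intro clinear_tensor_lift cbilinearI clinear_tensor_lift_param)
      (simp_all add: clinear_iff tensor_elem_simps)
  have lt: "clinear (\<lambda>t. t \<otimes> z)" for z :: 'a by (simp add: clinear_iff tensor_elem_simps)
  have "T (tensor_map id \<Delta> (\<Delta> a)) = sweedler (\<lambda>x y. T (x \<otimes> \<Delta> y)) a"
    unfolding comult_sweedler[of a]
    by (simp add: sweedler_clinear[OF lT] sweedler_clinear[OF clinear_tensor_map[OF clinear_id comult_linear]]
        tensor_map_elem[OF clinear_id comult_linear])
  also have "\<dots> = sweedler (\<lambda>x y. sweedler (F x) y) a"
    unfolding T_def by (simp add: tensor_lift_elem[OF T] tensor_lift_comult[OF F])
  finally have r: "T (tensor_map id \<Delta> (\<Delta> a)) = sweedler (\<lambda>x y. sweedler (F x) y) a" .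
  have s: "T (tensor_assoc (\<Delta> x \<otimes> y)) = sweedler (\<lambda>u v. F u v y) x" for x y
    unfolding comult_sweedler[of x]
    by (simp add: sweedler_clinear[OF lt] sweedler_clinear[OF lA] sweedler_clinear[OF lT]
        tensor_assoc_elem) (simp add: T_def tensor_lift_elem[OF T] tensor_lift_elem[OF F])
  have "T (tensor_assoc (tensor_map \<Delta> id (\<Delta> a))) = sweedler (\<lambda>x y. T (tensor_assoc (\<Delta> x \<otimes> y))) a"
    unfolding comult_sweedler[of a]
    by (simp add: sweedler_clinear[OF lT] sweedler_clinear[OF lA]
        sweedler_clinear[OF clinear_tensor_map[OF comult_linear clinear_id]]
        tensor_map_elem[OF comult_linear clinear_id])
  also have "\<dots> = sweedler (\<lambda>x y. sweedler (\<lambda>u v. F u v y) x) a" by (simp add: s)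
  finally show ?thesis using r coassociative by simp
qed

lemma sweedler_counit_left: "clinear f \<Longrightarrow> sweedler (\<lambda>x y. \<epsilon> x *\<^sub>C f y) a = f a"
proof -
  assume f: "clinear f"
  have b: "cbilinear (\<lambda>x y. \<epsilon> x *\<^sub>C y)"
    by (intro cbilinearI clinear_scale_left clinear_scale_right counit_linear clinear_ident)
  have "a = sweedler (\<lambda>x y. \<epsilon> x *\<^sub>C y) a"
    using counit_left[of a] unfolding tensor_lift_comult[OF b] by (rule sym)
  then have "f a = f (sweedler (\<lambda>x y. \<epsilon> x *\<^sub>C y) a)" by (rule arg_cong)
  then show ?thesis by (simp add: sweedler_clinear[OF f] clinear_scaleC[OF f])
qed

lemma sweedler_counit_right: "clinear f \<Longrightarrow> sweedler (\<lambda>x y. \<epsilon> y *\<^sub>C f x) a = f a"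
proof -
  assume f: "clinear f"
  have b: "cbilinear (\<lambda>x y. \<epsilon> y *\<^sub>C x)"
    by (intro cbilinearI clinear_scale_left clinear_scale_right counit_linear clinear_ident)
  have "a = sweedler (\<lambda>x y. \<epsilon> y *\<^sub>C x) a"
    using counit_right[of a] unfolding tensor_lift_comult[OF b] by (rule sym)
  then have "f a = f (sweedler (\<lambda>x y. \<epsilon> y *\<^sub>C x) a)" by (rule arg_cong)
  then show ?thesis by (simp add: sweedler_clinear[OF f] clinear_scaleC[OF f])
qed

lemma sweedler_antipode_left: "sweedler (\<lambda>x y. S x * y) a = \<epsilon> a *\<^sub>C 1"
  using antipode_left[of a]
  by (simp add: tensor_lift_comult cbilinearI clinear_mult_left clinear_mult_right antipode_linear clinear_ident)

lemma sweedler_antipode_right: "sweedler (\<lambda>x y. x * S y) a = \<epsilon> a *\<^sub>C 1"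
  using antipode_right[of a]
  by (simp add: tensor_lift_comult cbilinearI clinear_mult_left clinear_mult_right antipode_linear clinear_ident)

text \<open>Applying the lift of \<open>f\<close> to \<open>comult_mult\<close> replaces the chosen
  legs of \<open>a * b\<close> by products of legs of \<open>a\<close> and \<open>b\<close>.\<close>

lemma sweedler_mult:
  assumes "cbilinear f"
  shows "sweedler f (a * b) = sweedler (\<lambda>x y. sweedler (\<lambda>u v. f (x * u) (y * v)) b) a"
proof -
  have 1: "cbilinear (\<lambda>c d. (a * c) \<otimes> (b * d))" for a b :: 'a
    by (simp add: semi_bilinear_def distrib_left mult_scaleC_right tensor_elem_simps)
  have 2: "cbilinear (\<lambda>a b. tensor_lift (\<lambda>c d. (a * c) \<otimes> (b * d)) t)" for t :: "('a,'a) tensor"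
    by (intro cbilinearI clinear_tensor_lift_param 1)
      (simp_all add: clinear_iff distrib_right mult_scaleC_left tensor_elem_simps)
  have "\<Delta> (a * b) =
      tensor_lift (\<lambda>x y. tensor_lift (\<lambda>u v. (x * u) \<otimes> (y * v)) (\<Delta> b)) (\<Delta> a)"
    unfolding comult_mult tensor_mult_def ..
  also have "\<dots> = sweedler (\<lambda>x y. sweedler (\<lambda>u v. (x * u) \<otimes> (y * v)) b) a"
    by (subst tensor_lift_comult[OF 2]) (simp only: tensor_lift_comult[OF 1])
  finally have "sweedler f (a * b) = tensor_lift f \<dots>"
    by (simp only: tensor_lift_comult[OF assms, symmetric])
  then show ?thesis
    by (simp only: sweedler_clinear[OF clinear_tensor_lift[OF assms]] tensor_lift_elem[OF assms])
qed

lemma sweedler_one: "cbilinear f \<Longrightarrow> sweedler f 1 = f 1 1"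
  using tensor_lift_comult[of f 1] by (simp add: comult_one tensor_lift_elem)

lemma sweedler_map:
  assumes "clinear \<beta>" "\<Delta> (\<beta> a) = tensor_map \<beta> \<beta> (\<Delta> a)" "cbilinear f"
  shows "sweedler f (\<beta> a) = sweedler (\<lambda>x y. f (\<beta> x) (\<beta> y)) a"
proof -
  have "\<Delta> (\<beta> a) = tensor_map \<beta> \<beta> (sweedler (\<otimes>) a)"
    using assms(2) by (simp only: comult_sweedler[of a])
  also have "\<dots> = sweedler (\<lambda>x y. \<beta> x \<otimes> \<beta> y) a"
    by (simp only: sweedler_clinear[OF clinear_tensor_map[OF assms(1) assms(1)]]
        tensor_map_elem[OF assms(1) assms(1)])
  finally have "sweedler f (\<beta> a) = tensor_lift f \<dots>"
    by (simp only: tensor_lift_comult[OF assms(3), symmetric])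
  then show ?thesis
    by (simp only: sweedler_clinear[OF clinear_tensor_lift[OF assms(3)]] tensor_lift_elem[OF assms(3)])
qed

lemma sweedler_star:
  assumes "cbilinear f"
  shows "sweedler f (star a) = sweedler (\<lambda>x y. f (star x) (star y)) a"
proof -
  \<comment> \<open>\<open>tensor_star\<close> is antilinear, so \<open>sweedler_clinear\<close>
    does not apply to it; its additivity over finite sums is derived directly.\<close>
  have add: "tensor_star (s + t) = tensor_star s + tensor_star t" for s t :: "('a,'a) tensor"
    unfolding tensor_star_def
    by (rule sigma_cnj.semi_lift_add) (simp add: semi_bilinear_def star_add star_scaleC tensor_elem_simps)
  then have "tensor_star 0 = (0 :: ('a,'a) tensor)" by (metis add_cancel_right_right)
  then have sum: "tensor_star (\<Sum>i\<in>A. g i :: ('a,'a) tensor) = (\<Sum>i\<in>A. tensor_star (g i))"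
    for A :: "nat set" and g
    by (induction A rule: infinite_finite_induct) (auto simp: add)
  have "\<Delta> (star a) = tensor_star (sweedler (\<otimes>) a)"
    by (simp only: comult_sweedler[of a] comult_star)
  also have "\<dots> = sweedler (\<lambda>x y. star x \<otimes> star y) a"
    by (simp only: sweedler_def sum tensor_star_elem)
  finally have "sweedler f (star a) = tensor_lift f \<dots>"
    by (simp only: tensor_lift_comult[OF assms, symmetric])
  then show ?thesis
    by (simp only: sweedler_clinear[OF clinear_tensor_lift[OF assms]] tensor_lift_elem[OF assms])
qed

end


section \<open>The antipode\<close>

lemma star_zero [simp]: "star 0 = (0 :: 'a::complex_star_algebra)"
  using star_add[of "0::'a" 0] by simp

lemma star_one [simp]: "star 1 = (1 :: 'a::complex_star_algebra)"
  by (metis mult.left_neutral star_mult star_star)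

lemma clinear_star_star: "clinear f \<Longrightarrow> clinear (\<lambda>x. star (f (star x)))"
  by (simp add: clinear_iff star_add star_scaleC)

context hopf_star_algebra
begin

lemma clinear_sweedler_comp: "cbilinear f \<Longrightarrow> clinear g \<Longrightarrow> clinear (\<lambda>x. sweedler f (g x))"
  by (rule clinear_compose_fun[OF clinear_sweedler])

text \<open>With these rules \<open>intro\<close> reduces linearity of a Sweedler expression in one
  variable to that of its building blocks.\<close>

lemmas linear_intros = cbilinearI clinear_ident clinear_mult_left clinear_mult_right clinear_scale_left
  clinear_scale_right clinear_sweedler_param clinear_sweedler_comp
  clinear_compose_fun[OF antipode_linear] clinear_compose_fun[OF counit_linear]

lemma star_sweedler: "star (sweedler f a) = sweedler (\<lambda>x y. star (f x y)) a"
proof -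
  have "star (\<Sum>i\<in>A. g i :: 'c::complex_star_algebra) = (\<Sum>i\<in>A. star (g i))" for A :: "nat set" and g
    by (induction A rule: infinite_finite_induct) (auto simp: star_add)
  then show ?thesis by (simp add: sweedler_def)
qed

text \<open>In the convolution algebra of linear maps, a left inverse \<open>f\<close> and a right
  inverse \<open>h\<close> of \<open>g\<close> agree: both equal the product of \<open>f\<close>,
  \<open>g\<close> and \<open>h\<close>. Coassociativity is the associativity of that
  product.\<close>

lemma convolution_inverse_unique:
  fixes f g h :: "'a \<Rightarrow> 'a"
  assumes "clinear f" "clinear g" "clinear h"
    and fg: "\<And>a. sweedler (\<lambda>x y. f x * g y) a = \<epsilon> a *\<^sub>C 1"
    and gh: "\<And>a. sweedler (\<lambda>x y. g x * h y) a = \<epsilon> a *\<^sub>C 1"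
  shows "f a = h a"
proof -
  have "h a = sweedler (\<lambda>x y. \<epsilon> x *\<^sub>C h y) a"
    by (rule sweedler_counit_left[symmetric]) fact
  also have "\<dots> = sweedler (\<lambda>x y. sweedler (\<lambda>u v. f u * g v) x * h y) a"
    by (simp add: fg mult_scaleC_left)
  also have "\<dots> = sweedler (\<lambda>x y. sweedler (\<lambda>u v. f u * g v * h y) x) a"
    by (simp only: sweedler_mult_right)
  also have "\<dots> = sweedler (\<lambda>x y. sweedler (\<lambda>u v. f x * g u * h v) y) a"
    by (rule sweedler_coassoc) (intro linear_intros assms)+
  also have "\<dots> = sweedler (\<lambda>x y. f x * sweedler (\<lambda>u v. g u * h v) y) a"
    by (simp only: sweedler_mult_left mult.assoc)
  also have "\<dots> = sweedler (\<lambda>x y. \<epsilon> y *\<^sub>C f x) a"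
    by (simp add: gh mult_scaleC_right)
  also have "\<dots> = f a"
    by (rule sweedler_counit_right) fact
  finally show ?thesis by simp
qed

text \<open>The same argument for bilinear maps, that is, for convolution over the coalgebra
  structure of the tensor square. It is what antimultiplicativity of \<open>S\<close>
  requires.\<close>

lemma convolution_inverse_unique2:
  fixes f g h :: "'a \<Rightarrow> 'a \<Rightarrow> 'a"
  assumes f: "\<And>b. clinear (\<lambda>a. f a b)" "\<And>a. clinear (f a)"
    and g: "\<And>b. clinear (\<lambda>a. g a b)" "\<And>a. clinear (g a)"
    and h: "\<And>b. clinear (\<lambda>a. h a b)" "\<And>a. clinear (h a)"
    and fg: "\<And>a b. sweedler (\<lambda>x y. sweedler (\<lambda>u v. f x u * g y v) b) a = (\<epsilon> a * \<epsilon> b) *\<^sub>C 1"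
    and gh: "\<And>a b. sweedler (\<lambda>x y. sweedler (\<lambda>u v. g x u * h y v) b) a = (\<epsilon> a * \<epsilon> b) *\<^sub>C 1"
  shows "f a b = h a b"
proof -
  note f' = clinear_compose_fun[OF f(1)] clinear_compose_fun[OF f(2)]
  note g' = clinear_compose_fun[OF g(1)] clinear_compose_fun[OF g(2)]
  note h' = clinear_compose_fun[OF h(1)] clinear_compose_fun[OF h(2)]
  have "h a b = sweedler (\<lambda>x y. \<epsilon> x *\<^sub>C h y b) a"
    by (rule sweedler_counit_left[symmetric]) (rule h)
  also have "\<dots> = sweedler (\<lambda>x y. \<epsilon> x *\<^sub>C sweedler (\<lambda>u v. \<epsilon> u *\<^sub>C h y v) b) a"
    by (simp add: sweedler_counit_left h)
  also have "\<dots> = sweedler (\<lambda>x y. sweedler (\<lambda>u v.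
      sweedler (\<lambda>p q. sweedler (\<lambda>r s. f p r * g q s) u) x * h y v) b) a"
    by (simp add: fg mult_scaleC_left sweedler_scaleC)
  also have "\<dots> = sweedler (\<lambda>x y. sweedler (\<lambda>u v.
      sweedler (\<lambda>p q. sweedler (\<lambda>r s. f p r * g q s * h y v) u) x) b) a"
    by (simp only: sweedler_mult_right)
  \<comment> \<open>After the swap the two sums coming from \<open>a\<close> are adjacent, and so
    are the two coming from \<open>b\<close>; coassociativity is then applied to each pair in
    turn.\<close>
  also have "\<dots> = sweedler (\<lambda>x y. sweedler (\<lambda>p q.
      sweedler (\<lambda>u v. sweedler (\<lambda>r s. f p r * g q s * h y v) u) b) x) a"
    by (subst sweedler_swap) (rule refl)
  also have "\<dots> = sweedler (\<lambda>x y. sweedler (\<lambda>p q.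
      sweedler (\<lambda>u v. sweedler (\<lambda>r s. f p u * g q r * h y s) v) b) x) a"
    by (subst sweedler_coassoc[where F = "\<lambda>r s v. f _ r * g _ s * h _ v"]) (rule refl | intro linear_intros f g h)+
  also have "\<dots> = sweedler (\<lambda>x y. sweedler (\<lambda>p q.
      sweedler (\<lambda>u v. sweedler (\<lambda>r s. f x u * g p r * h q s) v) b) y) a"
    by (rule sweedler_coassoc) (intro linear_intros f g h)+
  also have "\<dots> = sweedler (\<lambda>x y. sweedler (\<lambda>u v.
      sweedler (\<lambda>p q. sweedler (\<lambda>r s. f x u * g p r * h q s) v) y) b) a"
    by (subst sweedler_swap) (rule refl)
  also have "\<dots> = sweedler (\<lambda>x y. sweedler (\<lambda>u v.
      f x u * sweedler (\<lambda>p q. sweedler (\<lambda>r s. g p r * h q s) v) y) b) a"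
    by (simp only: sweedler_mult_left mult.assoc)
  also have "\<dots> = sweedler (\<lambda>x y. \<epsilon> y *\<^sub>C sweedler (\<lambda>u v. \<epsilon> v *\<^sub>C f x u) b) a"
    by (simp add: gh mult_scaleC_right sweedler_scaleC)
  also have "\<dots> = sweedler (\<lambda>x y. \<epsilon> y *\<^sub>C f x b) a"
    by (simp add: sweedler_counit_right f)
  also have "\<dots> = f a b"
    by (rule sweedler_counit_right) (rule f)
  finally show ?thesis by simp
qed

text \<open>On the tensor square, \<open>S (a * b)\<close> is a left and \<open>S b * S a\<close> a
  right convolution inverse of multiplication.\<close>

lemma antipode_mult: "S (a * b) = S b * S a"
proof (rule convolution_inverse_unique2[where f = "\<lambda>a b. S (a * b)" and g = "(*)" and h = "\<lambda>a b. S b * S a"])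
  fix a b
  have "sweedler (\<lambda>p q. S p * q) (a * b) = \<epsilon> (a * b) *\<^sub>C 1"
    by (rule sweedler_antipode_left)
  then show "sweedler (\<lambda>x y. sweedler (\<lambda>u v. S (x * u) * (y * v)) b) a = (\<epsilon> a * \<epsilon> b) *\<^sub>C 1"
    by (subst (asm) sweedler_mult) (intro linear_intros, simp add: counit_mult)
next
  fix a b
  have "sweedler (\<lambda>x y. sweedler (\<lambda>u v. x * u * (S v * S y)) b) a =
      sweedler (\<lambda>x y. x * sweedler (\<lambda>u v. u * S v) b * S y) a"
    by (simp only: sweedler_mult_left sweedler_mult_right mult.assoc)
  also have "\<dots> = \<epsilon> b *\<^sub>C sweedler (\<lambda>x y. x * S y) a"
    by (simp add: sweedler_antipode_right[of b] mult_scaleC_left mult_scaleC_right sweedler_scaleC)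
  finally show "sweedler (\<lambda>x y. sweedler (\<lambda>u v. x * u * (S v * S y)) b) a = (\<epsilon> a * \<epsilon> b) *\<^sub>C 1"
    by (simp add: sweedler_antipode_right mult.commute[of "\<epsilon> a"])
qed (intro linear_intros)+

lemma antipode_one: "S 1 = 1"
proof -
  have "cbilinear (\<lambda>x y. S x * y)" by (intro linear_intros)
  from sweedler_one[OF this] show ?thesis
    by (simp add: sweedler_antipode_left counit_one)
qed

text \<open>Inserting the counit and using multiplicativity of \<open>\<epsilon>\<close> turns
  \<open>\<epsilon> (S a)\<close> into the value of \<open>\<epsilon>\<close> on the right antipode
  axiom.\<close>

lemma counit_antipode: "\<epsilon> (S a) = \<epsilon> a"
proof -
  have "\<epsilon> (S a) = sweedler (\<lambda>x y. \<epsilon> x *\<^sub>C \<epsilon> (S y)) a"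
    by (rule sweedler_counit_left[symmetric]) (intro linear_intros)
  also have "\<dots> = \<epsilon> (sweedler (\<lambda>x y. x * S y) a)"
    by (simp add: sweedler_clinear[OF counit_linear] counit_mult)
  also have "\<dots> = \<epsilon> a"
    by (simp add: sweedler_antipode_right clinear_scaleC[OF counit_linear] counit_one)
  finally show ?thesis .
qed

text \<open>The identity is a left convolution inverse of \<open>S\<close>. The composite is a right
  one: since \<open>S\<close> and \<open>star\<close> both reverse products, the convolution becomes
  \<open>S\<close> and \<open>star\<close> applied to the antipode axiom at
  \<open>star a\<close>.\<close>

lemma antipode_star_antipode_star: "S (star (S (star a))) = a"
proof -
  have "a = S (star (S (star a)))"
  proof (rule convolution_inverse_unique[where f = "\<lambda>a. a" and g = S])
    fix a
    have "sweedler (\<lambda>x y. S x * S (star (S (star y)))) a =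
        S (star (sweedler (\<lambda>x y. star x * S (star y)) a))"
      by (simp add: star_sweedler sweedler_clinear[OF antipode_linear] star_mult antipode_mult)
    also have "sweedler (\<lambda>x y. star x * S (star y)) a = sweedler (\<lambda>x y. x * S y) (star a)"
      by (rule sweedler_star[symmetric]) (intro linear_intros)
    finally show "sweedler (\<lambda>x y. S x * S (star (S (star y)))) a = \<epsilon> a *\<^sub>C 1"
      by (simp add: sweedler_antipode_right star_scaleC counit_star antipode_one
          clinear_scaleC[OF antipode_linear])
  qed (intro linear_intros antipode_linear clinear_star_star sweedler_antipode_right)+
  then show ?thesis ..
qed

end

text \<open>The conditions of \<open>admissible_bijection\<close> in pointwise form, without the two
  bijectivity conditions, which are assumed where they are used. By \<open>aut_star\<close>,
  \<alpha> has the inverse \<open>star \<circ> \<alpha> \<circ> star\<close>.\<close>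

locale bialgebra_automorphism = hopf_star_algebra +
  fixes \<alpha> :: "'a::complex_star_algebra \<Rightarrow> 'a"
  assumes aut_linear: "clinear \<alpha>"
    and aut_mult: "\<alpha> (a * b) = \<alpha> a * \<alpha> b"
    and aut_one: "\<alpha> 1 = 1"
    and aut_comult: "\<Delta> (\<alpha> a) = tensor_map \<alpha> \<alpha> (\<Delta> a)"
    and aut_star: "\<alpha> (star (\<alpha> (star a))) = a"
begin

lemmas linear_intros_aut = linear_intros clinear_compose_fun[OF aut_linear]

lemma star_aut_star: "star (\<alpha> (star (\<alpha> a))) = a"
  using aut_star[of "star a"] by (metis star_star)

text \<open>Applying the inverse of \<alpha> to the left counit law at \<open>\<alpha> a\<close>
  shows that \<open>\<epsilon> \<circ> \<alpha>\<close> is a left counit as well. A left counit and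
  the right counit \<epsilon> coincide, as evaluation under \<epsilon> shows.\<close>

lemma counit_aut: "\<epsilon> (\<alpha> a) = \<epsilon> a"
proof -
  let ?f = "\<lambda>x y. \<epsilon> x *\<^sub>C y"
  have "sweedler (\<lambda>x y. ?f (\<alpha> x) (\<alpha> y)) a = sweedler ?f (\<alpha> a)"
    by (rule sweedler_map[OF aut_linear aut_comult, symmetric]) (intro linear_intros)
  also have "\<dots> = \<alpha> a"
    by (rule sweedler_counit_left) (intro linear_intros)
  finally have "star (\<alpha> (star (sweedler (\<lambda>x y. ?f (\<alpha> x) (\<alpha> y)) a))) = a"
    by (simp add: star_aut_star)
  moreover have "star (\<alpha> (star (sweedler (\<lambda>x y. ?f (\<alpha> x) (\<alpha> y)) a))) = sweedler (\<lambda>x y. \<epsilon> (\<alpha> x) *\<^sub>C y) a"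
    by (simp add: star_sweedler sweedler_clinear[OF aut_linear] star_scaleC
        clinear_scaleC[OF aut_linear] star_aut_star)
  ultimately have "\<epsilon> a = \<epsilon> (sweedler (\<lambda>x y. \<epsilon> (\<alpha> x) *\<^sub>C y) a)" by simp
  also have "\<dots> = sweedler (\<lambda>x y. \<epsilon> y *\<^sub>C \<epsilon> (\<alpha> x)) a"
    by (simp add: sweedler_clinear[OF counit_linear] clinear_scaleC[OF counit_linear] mult.commute)
  also have "\<dots> = \<epsilon> (\<alpha> a)"
    by (rule sweedler_counit_right) (intro linear_intros_aut)
  finally show ?thesis by simp
qed

text \<open>Both sides are convolution inverses of \<alpha>, one on the left and one on the
  right.\<close>

lemma aut_antipode: "\<alpha> (S a) = S (\<alpha> a)"
proof (rule convolution_inverse_unique[where f = "\<lambda>a. \<alpha> (S a)" and g = \<alpha> and h = "\<lambda>a. S (\<alpha> a)"])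
  fix a
  have "sweedler (\<lambda>x y. \<alpha> (S x) * \<alpha> y) a = \<alpha> (sweedler (\<lambda>x y. S x * y) a)"
    by (simp add: sweedler_clinear[OF aut_linear] aut_mult)
  then show "sweedler (\<lambda>x y. \<alpha> (S x) * \<alpha> y) a = \<epsilon> a *\<^sub>C 1"
    by (simp add: sweedler_antipode_left clinear_scaleC[OF aut_linear] aut_one)
  have "sweedler (\<lambda>x y. \<alpha> x * S (\<alpha> y)) a = sweedler (\<lambda>x y. x * S y) (\<alpha> a)"
    by (rule sweedler_map[OF aut_linear aut_comult, symmetric]) (intro linear_intros)
  then show "sweedler (\<lambda>x y. \<alpha> x * S (\<alpha> y)) a = \<epsilon> a *\<^sub>C 1"
    by (simp add: sweedler_antipode_right counit_aut)
qed (intro linear_intros_aut aut_linear)+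

text \<open>This makes invariance under \<open>S \<circ> \<alpha>\<close> compatible with passing
  from \<open>L\<close> to \<open>\<lambda>a. cnj (L (star a))\<close>.\<close>

lemma antipode_aut_star: "S (\<alpha> (star (S (\<alpha> (star a))))) = a"
proof -
  have "\<alpha> (star (S (\<alpha> (star a)))) = \<alpha> (star (\<alpha> (star (star (S (star a))))))"
    by (simp add: aut_antipode)
  then show ?thesis by (simp only: aut_star antipode_star_antipode_star)
qed

end


section \<open>Functionals with a given coboundary\<close>

context hopf_star_algebra
begin

text \<open>The hypothesis \<open>cocyc\<close> is the Hochschild 2-cocycle identity with \<epsilon>
  acting on both sides. It splits each summand of the expanded left side into three terms, which
  collapse by the antipode and counit laws.\<close>

lemma two_cocycle_antipode:
  fixes \<psi> :: "'a \<Rightarrow> 'a \<Rightarrow> complex"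
  assumes bil: "cbilinear \<psi>"
    and cocyc: "\<And>a b c. \<psi> (a * b) c = \<psi> a (b * c) - \<epsilon> c * \<psi> a b + \<epsilon> a * \<psi> b c"
    and one: "\<And>c. \<psi> 1 c = 0"
  shows "sweedler (\<lambda>x y. \<psi> x (S y)) (a * b) =
    \<epsilon> a * sweedler (\<lambda>x y. \<psi> x (S y)) b + \<epsilon> b * sweedler (\<lambda>x y. \<psi> x (S y)) a
    - \<psi> a b - \<psi> (S b) (S a)"
proof -
  let ?K = "sweedler (\<lambda>x y. \<psi> x (S y))"
  have \<psi>1: "clinear (\<lambda>x. \<psi> x y)" and \<psi>2: "clinear (\<psi> x)" for x y
    using bil by (auto simp: cbilinear_iff)
  note linear_intros = linear_intros clinear_compose_fun[OF \<psi>1] clinear_compose_fun[OF \<psi>2]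
  \<comment> \<open>The cocycle identity read backwards moves \<open>S v\<close> into the first
    argument, where the antipode axiom produces a multiple of the unit and \<open>one\<close>
    applies.\<close>
  have "sweedler (\<lambda>u v. \<psi> u (S v * S a)) b =
      sweedler (\<lambda>u v. \<psi> (u * S v) (S a) + \<epsilon> a * \<psi> u (S v) - \<epsilon> u *\<^sub>C \<psi> (S v) (S a)) b"
    by (simp add: cocyc counit_antipode)
  also have "\<dots> = \<psi> (sweedler (\<lambda>u v. u * S v) b) (S a) + \<epsilon> a * ?K b
      - sweedler (\<lambda>u v. \<epsilon> u *\<^sub>C \<psi> (S v) (S a)) b"
    unfolding sweedler_add sweedler_diff sweedler_mult_left sweedler_clinear[OF \<psi>1] ..
  also have "sweedler (\<lambda>u v. \<epsilon> u *\<^sub>C \<psi> (S v) (S a)) b = \<psi> (S b) (S a)"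
    by (rule sweedler_counit_left) (intro linear_intros)
  finally have 1: "sweedler (\<lambda>u v. \<psi> u (S v * S a)) b = \<epsilon> a * ?K b - \<psi> (S b) (S a)"
    by (simp only: sweedler_antipode_right clinear_scaleC[OF \<psi>1] one) simp
  have "?K (a * b) = sweedler (\<lambda>x y. sweedler (\<lambda>u v. \<psi> (x * u) (S (y * v))) b) a"
    by (rule sweedler_mult) (intro linear_intros)
  \<comment> \<open>Here the cocycle identity has third argument \<open>S v * S y\<close>. The first
    of the three terms contracts over the legs of \<open>b\<close>, the second over the counits, and
    the third is the sum computed in \<open>1\<close>.\<close>
  also have "\<dots> = sweedler (\<lambda>x y. sweedler (\<lambda>u v.
      \<psi> x (u * S v * S y) - \<epsilon> y *\<^sub>C \<epsilon> v *\<^sub>C \<psi> x u + \<epsilon> x * \<psi> u (S v * S y)) b) a"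
    by (simp add: antipode_mult cocyc counit_mult counit_antipode mult.assoc mult.left_commute)
  also have "\<dots> = sweedler (\<lambda>x y. \<psi> x (sweedler (\<lambda>u v. u * S v) b * S y)) a
      - sweedler (\<lambda>x y. \<epsilon> y *\<^sub>C sweedler (\<lambda>u v. \<epsilon> v *\<^sub>C \<psi> x u) b) a
      + sweedler (\<lambda>x y. \<epsilon> x *\<^sub>C sweedler (\<lambda>u v. \<psi> u (S v * S y)) b) a"
    unfolding sweedler_add sweedler_diff sweedler_mult_right sweedler_clinear[OF \<psi>2] sweedler_scaleC
    by simp
  also have "sweedler (\<lambda>x y. \<epsilon> x *\<^sub>C sweedler (\<lambda>u v. \<psi> u (S v * S y)) b) a =
      sweedler (\<lambda>u v. \<psi> u (S v * S a)) b"
    by (rule sweedler_counit_left) (intro linear_intros)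
  also have "sweedler (\<lambda>x y. \<epsilon> y *\<^sub>C sweedler (\<lambda>u v. \<epsilon> v *\<^sub>C \<psi> x u) b) a =
      sweedler (\<lambda>x y. \<epsilon> y *\<^sub>C \<psi> x b) a"
    by (subst sweedler_counit_right) (rule \<psi>2 refl)+
  also have "\<dots> = \<psi> a b"
    by (rule sweedler_counit_right) (rule \<psi>1)
  also have "sweedler (\<lambda>x y. \<psi> x (sweedler (\<lambda>u v. u * S v) b * S y)) a = \<epsilon> b * ?K a"
    by (simp add: sweedler_antipode_right mult_scaleC_left clinear_scaleC[OF \<psi>2] sweedler_mult_left)
  finally show ?thesis by (simp add: 1)
qed

lemma coboundary_antipode:
  fixes L :: "'a \<Rightarrow> complex"
  assumes L: "clinear L" "L 1 = 0"
    and cob: "\<And>a b. L (a * b) = \<epsilon> a * L b + L a * \<epsilon> b + \<psi> a b"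
  shows "L a + L (S a) = - sweedler (\<lambda>x y. \<psi> x (S y)) a"
proof -
  have "0 = L (sweedler (\<lambda>x y. x * S y) a)"
    by (simp add: sweedler_antipode_right clinear_scaleC[OF L(1)] L(2))
  also have "\<dots> = sweedler (\<lambda>x y. \<epsilon> x *\<^sub>C L (S y) + \<epsilon> y *\<^sub>C L x + \<psi> x (S y)) a"
    by (simp add: sweedler_clinear[OF L(1)] cob counit_antipode mult.commute)
  also have "\<dots> = L (S a) + L a + sweedler (\<lambda>x y. \<psi> x (S y)) a"
    unfolding sweedler_add
    by (simp only: sweedler_counit_right[OF L(1)]
        sweedler_counit_left[OF clinear_compose_fun[OF L(1) antipode_linear]])
  finally show ?thesis by (simp add: eq_neg_iff_add_eq_0 add.commute)
qed

end

section \<open>Invariant functionals: uniqueness and existence\<close>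

context bialgebra_automorphism
begin

lemma invariant_coboundary_unique:
  fixes L M :: "'a \<Rightarrow> complex"
  assumes surj: "surj (\<lambda>a. a + \<alpha> a)"
    and L: "clinear L" "L 1 = 0" "\<And>a. L (S (\<alpha> a)) = L a"
      "\<And>a b. L (a * b) = \<epsilon> a * L b + L a * \<epsilon> b + \<psi> a b"
    and M: "clinear M" "M 1 = 0" "\<And>a. M (S (\<alpha> a)) = M a"
      "\<And>a b. M (a * b) = \<epsilon> a * M b + M a * \<epsilon> b + \<psi> a b"
  shows "L = M"
proof
  fix a
  obtain b where a: "a = b + \<alpha> b" using surj by (rule surjE)
  show "L a = M a"
    \<comment> \<open>At \<open>\<alpha> b\<close> invariance turns
      \<open>L (S (\<alpha> b))\<close> into \<open>L b\<close>, so
      \<open>coboundary_antipode\<close> gives \<open>L\<close> and \<open>M\<close> the same value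
      at \<open>b + \<alpha> b\<close>.\<close>
    using coboundary_antipode[OF L(1,2,4), of "\<alpha> b"] coboundary_antipode[OF M(1,2,4), of "\<alpha> b"]
    by (simp add: a clinear_add[OF L(1)] clinear_add[OF M(1)] L(3) M(3) add.commute)
qed

lemma invariant_coboundary_exists:
  fixes \<psi> :: "'a \<Rightarrow> 'a \<Rightarrow> complex"
  assumes bij: "bij (\<lambda>a. a + \<alpha> a)"
    and surj: "surj (\<lambda>t. tensor_map id id t + tensor_map \<alpha> \<alpha> t)"
    and bil: "cbilinear \<psi>"
    and cocyc: "\<And>a b c. \<psi> (a * b) c = \<psi> a (b * c) - \<epsilon> c * \<psi> a b + \<epsilon> a * \<psi> b c"
    and one: "\<And>c. \<psi> 1 c = 0"
    and real: "\<And>a b. \<psi> a b = \<psi> (S (\<alpha> b)) (S (\<alpha> a))"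
    and herm: "\<And>a b. cnj (\<psi> a b) = \<psi> (star b) (star a)"
  obtains L where "clinear L" "L 1 = 0" "\<And>a. L (S (\<alpha> a)) = L a"
    "\<And>a b. L (a * b) = \<epsilon> a * L b + L a * \<epsilon> b + \<psi> a b" "\<And>a. L (star a) = cnj (L a)"
proof -
  define K where "K = sweedler (\<lambda>x y. \<psi> x (S y))"
  have \<psi>1: "clinear (\<lambda>x. \<psi> x y)" and \<psi>2: "clinear (\<psi> x)" for x y
    using bil by (auto simp: cbilinear_iff)
  have K: "clinear K"
    unfolding K_def
    by (intro clinear_sweedler cbilinearI \<psi>1 clinear_compose_fun[OF \<psi>2 antipode_linear])
  define T where "T = inv (\<lambda>a. a + \<alpha> a)"
  have T: "T a + \<alpha> (T a) = a" for a
    unfolding T_def using surj_f_inv_f[OF bij_is_surj[OF bij], of a] .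
  have T': "T (a + \<alpha> a) = a" for a
    unfolding T_def using inv_f_f[OF bij_is_inj[OF bij], of a] .
  have lT: "clinear T"
  proof (rule clinearI)
    fix x y c
    \<comment> \<open>The argument is rewritten as an image under \<open>id + \<alpha>\<close>, from
      which \<open>T'\<close> recovers the preimage.\<close>
    have "T (x + y) = T ((T x + T y) + \<alpha> (T x + T y))"
      using T[of x] T[of y] by (simp add: clinear_add[OF aut_linear] algebra_simps)
    then show "T (x + y) = T x + T y" by (simp only: T')
    have "T (c *\<^sub>C x) = T (c *\<^sub>C T x + \<alpha> (c *\<^sub>C T x))"
      by (simp only: clinear_scaleC[OF aut_linear] T flip: scaleC_add_right)
    then show "T (c *\<^sub>C x) = c *\<^sub>C T x" by (simp only: T')
  qed
  \<comment> \<open>The forced equation \<open>L (b + \<alpha> b) = - K (\<alpha> b)\<close>, solved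
    at \<open>b = T a\<close>.\<close>
  define L where "L a = - K (\<alpha> (T a))" for a
  have L: "clinear L"
    using clinear_compose_fun[OF K clinear_compose_fun[OF aut_linear lT]]
    unfolding clinear_iff L_def by simp
  have LK: "L a + L (\<alpha> a) = - K (\<alpha> a)" for a
    by (simp only: clinear_add[OF L, symmetric]) (simp only: L_def T')
  \<comment> \<open>The defect in the coboundary identity. It is bilinear, so it can be tested on
    the whole tensor square.\<close>
  define B where "B a b = L (a * b) - \<epsilon> a * L b - L a * \<epsilon> b - \<psi> a b" for a b
  have B: "cbilinear B"
    unfolding B_def
    by (intro linear_intros clinear_compose_fun[OF L] clinear_minus \<psi>1 \<psi>2 clinear_mult_left clinear_mult_right counit_linear L)
  have sym: "B a b + B (\<alpha> a) (\<alpha> b) = 0" for a b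
  proof -
    have "B a b + B (\<alpha> a) (\<alpha> b) = (L (a * b) + L (\<alpha> (a * b)))
        - \<epsilon> a * (L b + L (\<alpha> b)) - (L a + L (\<alpha> a)) * \<epsilon> b - \<psi> a b - \<psi> (\<alpha> a) (\<alpha> b)"
      by (simp add: B_def aut_mult counit_aut algebra_simps)
    also have "\<dots> = 0"
      \<comment> \<open>\<open>LK\<close> has to act before \<open>aut_mult\<close> splits
        \<open>\<alpha> (a * b)\<close>. The coboundary of \<open>K\<close> at
        \<open>\<alpha> a\<close>, \<open>\<alpha> b\<close> then contributes both \<psi> terms, one
        of them by \<open>real\<close>.\<close>
      unfolding LK
      unfolding aut_mult
      unfolding K_def two_cocycle_antipode[OF bil cocyc one, of "\<alpha> a"] counit_aut
      using real[of a b] by (simp add: algebra_simps)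
    finally show ?thesis .
  qed
  have B0: "tensor_lift B (tensor_map id id t + tensor_map \<alpha> \<alpha> t) = 0" for t
    unfolding tensor_map_id_id
  proof (induction t rule: tensor_induct)
    case (elem a b)
    then show ?case
      by (simp add: clinear_add[OF clinear_tensor_lift[OF B]] tensor_map_elem[OF aut_linear aut_linear]
          tensor_lift_elem[OF B] sym)
  next
    case (add s t)
    have eq: "s + t + tensor_map \<alpha> \<alpha> (s + t) =
        (s + tensor_map \<alpha> \<alpha> s) + (t + tensor_map \<alpha> \<alpha> t)"
      by (simp only: clinear_add[OF clinear_tensor_map[OF aut_linear aut_linear]] add_ac)
    show ?case
      unfolding eq by (subst clinear_add[OF clinear_tensor_lift[OF B]]) (simp only: add add_0)
  qed
  have cob: "L (a * b) = \<epsilon> a * L b + L a * \<epsilon> b + \<psi> a b" for a b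
  proof -
    obtain t where "a \<otimes> b = tensor_map id id t + tensor_map \<alpha> \<alpha> t"
      using surj by (rule surjE)
    then have "B a b = 0" using B0[of t] tensor_lift_elem[OF B, of a b] by simp
    then show ?thesis by (simp add: B_def algebra_simps)
  qed
  have L1: "L 1 = 0" using cob[of 1 1] by (simp add: counit_one one)
  have inv: "L (S (\<alpha> a)) = L a" for a
    using coboundary_antipode[OF L L1 cob, of "\<alpha> a"] LK[of a]
    by (simp add: K_def) (metis add.commute add_left_cancel)
  have "(\<lambda>a. cnj (L (star a))) = L"
  proof (rule invariant_coboundary_unique[OF bij_is_surj[OF bij] _ _ _ _ L L1 inv cob])
    show "clinear (\<lambda>a. cnj (L (star a)))"
      using L unfolding clinear_iff by (simp add: star_add star_scaleC)
    show "cnj (L (star 1)) = 0" by (simp add: L1)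
    \<comment> \<open>Invariance is used at \<open>star (S (\<alpha> a))\<close>, which
      \<open>S \<circ> \<alpha>\<close> sends to \<open>star a\<close>.\<close>
    show "cnj (L (star (S (\<alpha> a)))) = cnj (L (star a))" for a
      using inv[of "star (S (\<alpha> a))"] antipode_aut_star[of "star a"] by simp
    show "cnj (L (star (a * b))) = \<epsilon> a * cnj (L (star b)) + cnj (L (star a)) * \<epsilon> b + \<psi> a b" for a b
      by (simp add: star_mult cob counit_star herm algebra_simps)
  qed
  then have "cnj (cnj (L (star a))) = cnj (L a)" for a
    by (rule fun_cong[THEN arg_cong])
  then have "L (star a) = cnj (L a)" for a
    by simp
  with L L1 inv cob show thesis by (rule that)
qed

end


section \<open>Pre-Hilbert spaces and completions\<close>

text \<open>The numerical core of Cauchy-Schwarz: the quadratic expression is the form at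
  \<open>x + c y\<close>, with \<open>p\<close> the mixed term. Stated for numbers, it serves inner
  products and also the semidefinite form of the GNS quotient, where \<open>B\<close> may
  vanish.\<close>

lemma hermitian_quadratic_discriminant:
  fixes A B :: real and p :: complex
  assumes "\<And>c. 0 \<le> A + 2 * Re (c * p) + (cmod c)\<^sup>2 * B" "0 \<le> B"
  shows "(cmod p)\<^sup>2 \<le> A * B"
proof -
  have cpp: "cnj p * p = of_real ((cmod p)\<^sup>2)"
    by (metis complex_norm_square mult.commute)
  show ?thesis
  proof (cases "B = 0")
    case True
    have "p = 0"
    proof (rule ccontr)
      assume "p \<noteq> 0"
      then have "0 < (cmod p)\<^sup>2" by simp
      \<comment> \<open>This \<open>c\<close> makes the linear term equal to
        \<open>- 2 * (A + 1)\<close>, which is too negative for \<open>A \<ge> 0\<close>.\<close>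
      have "0 \<le> A + 2 * Re (- of_real ((A + 1) / (cmod p)\<^sup>2) * cnj p * p)"
        using assms(1)[of "- of_real ((A + 1) / (cmod p)\<^sup>2) * cnj p"] True by simp
      also have "- of_real ((A + 1) / (cmod p)\<^sup>2) * cnj p * p = - of_real ((A + 1) / (cmod p)\<^sup>2 * (cmod p)\<^sup>2)"
        by (simp only: mult.assoc cpp mult_minus_left of_real_mult)
      also have "(A + 1) / (cmod p)\<^sup>2 * (cmod p)\<^sup>2 = A + 1" using \<open>p \<noteq> 0\<close> by simp
      finally have "0 \<le> A - 2 * (A + 1)" by simp
      moreover have "0 \<le> A" using assms(1)[of 0] by simp
      ultimately show False by simp
    qed
    then show ?thesis using True by simp
  next
    case False
    then have B: "0 < B" using assms(2) by simp
    \<comment> \<open>The minimising scalar \<open>c = - cnj p / B\<close>.\<close>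
    have "0 \<le> A + 2 * Re (- of_real (1 / B) * cnj p * p) + (cmod p / B)\<^sup>2 * B"
      using assms(1)[of "- of_real (1 / B) * cnj p"] B by (simp add: norm_mult norm_divide)
    also have "- of_real (1 / B) * cnj p * p = - of_real ((cmod p)\<^sup>2 / B)"
      by (simp only: mult.assoc cpp mult_minus_left of_real_mult[symmetric]) simp
    also have "(cmod p / B)\<^sup>2 * B = (cmod p)\<^sup>2 / B"
      using B by (simp add: power2_eq_square)
    finally have "(cmod p)\<^sup>2 / B \<le> A" by simp
    then show ?thesis using B by (simp add: divide_le_eq)
  qed
qed

section \<open>Norm and distance of a pre-Hilbert space\<close>

context prehilbert_space
begin

definition vnorm :: "'h \<Rightarrow> real"
  where "vnorm x = sqrt (Re (ip D x x))"

lemmas vspace_closed = vadd_closed vzero_closed vscale_closed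

lemma ip_vadd_left: "x \<in> carrier D \<Longrightarrow> y \<in> carrier D \<Longrightarrow> z \<in> carrier D \<Longrightarrow>
    ip D (vadd D x y) z = ip D x z + ip D y z"
  by (metis vspace_closed ip_cnj ip_vadd complex_cnj_add)

lemma ip_vscale_left: "x \<in> carrier D \<Longrightarrow> y \<in> carrier D \<Longrightarrow> ip D (vscale D c x) y = cnj c * ip D x y"
  by (metis vspace_closed ip_cnj ip_vscale complex_cnj_mult)

lemmas ip_simps = ip_vadd ip_vscale ip_vadd_left ip_vscale_left

lemma ip_self: "x \<in> carrier D \<Longrightarrow> ip D x x = of_real ((vnorm x)\<^sup>2)"
  and ip_self_nonneg: "x \<in> carrier D \<Longrightarrow> 0 \<le> Re (ip D x x)"
  using ip_nonneg[of x] unfolding vnorm_def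
  by (auto simp: complex_nonneg_Reals_iff complex_eq_iff)

lemma vnorm_nonneg: "x \<in> carrier D \<Longrightarrow> 0 \<le> vnorm x"
  unfolding vnorm_def by (simp add: ip_self_nonneg)

lemma cauchy_schwarz:
  assumes x: "x \<in> carrier D" and y: "y \<in> carrier D"
  shows "cmod (ip D x y) \<le> vnorm x * vnorm y"
proof -
  have "(cmod (ip D x y))\<^sup>2 \<le> (vnorm x)\<^sup>2 * (vnorm y)\<^sup>2"
  proof (rule hermitian_quadratic_discriminant)
    fix c
    let ?z = "vadd D x (vscale D c y)"
    have "ip D ?z ?z = ip D x x + (c * ip D x y + cnj (c * ip D x y)) + c * cnj c * ip D y y"
      using x y by (simp add: vspace_closed ip_simps ip_cnj[of x y] algebra_simps)
    also have "\<dots> = of_real ((vnorm x)\<^sup>2 + 2 * Re (c * ip D x y) + (cmod c)\<^sup>2 * (vnorm y)\<^sup>2)"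
      by (simp only: complex_add_cnj complex_norm_square[symmetric] ip_self x y) simp
    finally have "ip D ?z ?z = \<dots>" .
    then show "0 \<le> (vnorm x)\<^sup>2 + 2 * Re (c * ip D x y) + (cmod c)\<^sup>2 * (vnorm y)\<^sup>2"
      using ip_self_nonneg[of ?z] x y by (simp only: vspace_closed Re_complex_of_real)
  qed simp
  then have "(cmod (ip D x y))\<^sup>2 \<le> (vnorm x * vnorm y)\<^sup>2"
    by (simp only: power_mult_distrib)
  then show ?thesis
    by (rule power2_le_imp_le) (simp add: vnorm_nonneg x y)
qed

lemma vnorm_vadd:
  assumes "x \<in> carrier D" "y \<in> carrier D"
  shows "vnorm (vadd D x y) \<le> vnorm x + vnorm y"
proof -
  have "(vnorm (vadd D x y))\<^sup>2 = Re (ip D (vadd D x y) (vadd D x y))"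
    by (simp add: vnorm_def ip_self_nonneg vspace_closed assms)
  also have "\<dots> = Re (ip D x x) + 2 * Re (ip D x y) + Re (ip D y y)"
    using assms by (simp add: vspace_closed ip_simps ip_cnj[of x y])
  also have "\<dots> = (vnorm x)\<^sup>2 + 2 * Re (ip D x y) + (vnorm y)\<^sup>2"
    using assms by (simp add: ip_self)
  also have "\<dots> \<le> (vnorm x)\<^sup>2 + 2 * (vnorm x * vnorm y) + (vnorm y)\<^sup>2"
    using complex_Re_le_cmod[of "ip D x y"] cauchy_schwarz[OF assms] by simp
  also have "\<dots> = (vnorm x + vnorm y)\<^sup>2" by (simp add: power2_sum)
  finally show ?thesis by (rule power2_le_imp_le) (simp add: vnorm_nonneg assms)
qed

lemma vnorm_vscale: "x \<in> carrier D \<Longrightarrow> vnorm (vscale D c x) = cmod c * vnorm x"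
proof -
  assume x: "x \<in> carrier D"
  have "ip D (vscale D c x) (vscale D c x) = c * cnj c * ip D x x"
    using x by (simp add: vspace_closed ip_simps)
  then have "ip D (vscale D c x) (vscale D c x) = of_real ((cmod c * vnorm x)\<^sup>2)"
    using x by (simp add: ip_self complex_norm_square[symmetric] power_mult_distrib del: complex_mult_cnj)
  then show ?thesis using x unfolding vnorm_def[of "vscale D c x"] by (simp add: vnorm_nonneg)
qed

abbreviation vminus :: "'h \<Rightarrow> 'h \<Rightarrow> 'h"
  where "vminus x y \<equiv> vadd D x (vscale D (-1) y)"

lemma vdist_eq: "vdist D x y = vnorm (vminus x y)"
  by (simp add: vdist_def vnorm_def Let_def)

lemma vdist_nonneg: "x \<in> carrier D \<Longrightarrow> y \<in> carrier D \<Longrightarrow> 0 \<le> vdist D x y"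
  by (simp add: vdist_eq vnorm_nonneg vspace_closed)

lemma vdist_refl: "x \<in> carrier D \<Longrightarrow> vdist D x x = 0"
  using ip_vscale[of "vzero D" "vzero D" 0] vadd_inverse[of x] vnorm_vscale[of x 0]
    add_vscale[of x 1 "-1"] vscale_one[of x]
  by (simp add: vdist_eq)

lemma vdist_commute:
  assumes "x \<in> carrier D" "y \<in> carrier D"
  shows "vdist D x y = vdist D y x"
proof -
  have "vminus y x = vscale D (-1) (vminus x y)"
    using assms by (simp add: vspace_closed vscale_vadd vscale_vscale vscale_one vadd_commute)
  then show ?thesis using assms by (simp add: vdist_eq vnorm_vscale vspace_closed)
qed

lemma vadd_left_commute: "x \<in> carrier D \<Longrightarrow> y \<in> carrier D \<Longrightarrow> z \<in> carrier D \<Longrightarrow>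
    vadd D x (vadd D y z) = vadd D y (vadd D x z)"
  by (metis vadd_assoc vadd_commute)

lemma vadd_inverse_cancel: "x \<in> carrier D \<Longrightarrow> y \<in> carrier D \<Longrightarrow>
    vadd D x (vadd D (vscale D (-1) x) y) = y"
  by (metis vspace_closed vadd_assoc vadd_inverse vadd_zero)

lemma vdist_triangle:
  assumes "x \<in> carrier D" "y \<in> carrier D" "z \<in> carrier D"
  shows "vdist D x z \<le> vdist D x y + vdist D y z"
proof -
  have "vminus x z = vadd D (vminus x y) (vminus y z)"
    using assms by (simp add: vspace_closed vadd_assoc vadd_left_commute vadd_inverse_cancel vadd_commute)
  then show ?thesis using assms by (simp add: vdist_eq vnorm_vadd vspace_closed)
qed

lemma vdist_vadd:
  assumes "x \<in> carrier D" "y \<in> carrier D" "x' \<in> carrier D" "y' \<in> carrier D"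
  shows "vdist D (vadd D x y) (vadd D x' y') \<le> vdist D x x' + vdist D y y'"
proof -
  have "vminus (vadd D x y) (vadd D x' y') = vadd D (vminus x x') (vminus y y')"
    using assms by (simp add: vspace_closed vadd_assoc vadd_left_commute vscale_vadd)
  then show ?thesis using assms by (simp add: vdist_eq vnorm_vadd vspace_closed)
qed

lemma vdist_vscale:
  assumes "x \<in> carrier D" "y \<in> carrier D"
  shows "vdist D (vscale D c x) (vscale D c y) = cmod c * vdist D x y"
proof -
  have "vminus (vscale D c x) (vscale D c y) = vscale D c (vminus x y)"
    using assms by (simp add: vspace_closed vscale_vadd vscale_vscale mult.commute)
  then show ?thesis using assms by (simp add: vdist_eq vnorm_vscale vspace_closed)
qed

text \<open>The reverse triangle inequality; it makes the norms along a Cauchy sequence Cauchy,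
  hence bounded.\<close>

lemma vnorm_diff_le:
  assumes x: "x \<in> carrier D" and y: "y \<in> carrier D"
  shows "\<bar>vnorm x - vnorm y\<bar> \<le> vdist D x y"
proof -
  have *: "vnorm x \<le> vdist D x y + vnorm y" if "x \<in> carrier D" "y \<in> carrier D" for x y
  proof -
    have "x = vadd D (vminus x y) y"
      using that by (metis vspace_closed vadd_assoc vadd_commute vadd_inverse_cancel)
    then show ?thesis using that vnorm_vadd[of "vminus x y" y] by (simp add: vdist_eq vspace_closed)
  qed
  from *[OF x y] *[OF y x] vdist_commute[OF x y] show ?thesis by simp
qed

text \<open>Changing one argument at a time and applying Cauchy-Schwarz gives this continuity
  estimate, the basis for inner products of classes in the completion.\<close>

lemma ip_diff_le:
  assumes "x \<in> carrier D" "y \<in> carrier D" "x' \<in> carrier D" "y' \<in> carrier D"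
  shows "cmod (ip D x y - ip D x' y') \<le> vnorm x * vdist D y y' + vdist D x x' * vnorm y'"
proof -
  have "ip D x y - ip D x' y' = ip D x (vminus y y') + ip D (vminus x x') y'"
    using assms by (simp add: vspace_closed ip_simps)
  then show ?thesis
    using norm_triangle_ineq[of "ip D x (vminus y y')" "ip D (vminus x x') y'"]
      cauchy_schwarz[of x "vminus y y'"] cauchy_schwarz[of "vminus x x'" y'] assms
    by (simp add: vdist_eq vspace_closed)
qed

section \<open>Cauchy sequences\<close>

lemma cauchy_seqs_carrier: "X \<in> cauchy_seqs D \<Longrightarrow> X n \<in> carrier D"
  by (auto simp: cauchy_seqs_def)

lemma cauchy_seqsD:
  "X \<in> cauchy_seqs D \<Longrightarrow> 0 < e \<Longrightarrow> \<exists>N. \<forall>m\<ge>N. \<forall>n\<ge>N. vdist D (X m) (X n) < e"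
  by (auto simp: cauchy_seqs_def)

lemma cauchy_seqs_const: "x \<in> carrier D \<Longrightarrow> (\<lambda>n. x) \<in> cauchy_seqs D"
  by (auto simp: cauchy_seqs_def vdist_refl)

lemma cauchy_seqs_vadd:
  assumes X: "X \<in> cauchy_seqs D" and Y: "Y \<in> cauchy_seqs D"
  shows "(\<lambda>n. vadd D (X n) (Y n)) \<in> cauchy_seqs D"
  unfolding cauchy_seqs_def
proof (safe)
  fix n show "vadd D (X n) (Y n) \<in> carrier D"
    by (simp add: vspace_closed cauchy_seqs_carrier assms)
next
  fix e :: real assume "e > 0"
  then obtain M N where M: "\<forall>m\<ge>M. \<forall>n\<ge>M. vdist D (X m) (X n) < e / 2"
    and N: "\<forall>m\<ge>N. \<forall>n\<ge>N. vdist D (Y m) (Y n) < e / 2"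
    using cauchy_seqsD[OF X] cauchy_seqsD[OF Y] by (meson half_gt_zero)
  have "vdist D (vadd D (X m) (Y m)) (vadd D (X n) (Y n)) < e" if "m \<ge> max M N" "n \<ge> max M N" for m n
    using vdist_vadd[of "X m" "Y m" "X n" "Y n"] M[rule_format, of m n] N[rule_format, of m n] that
    by (simp add: cauchy_seqs_carrier assms)
  then show "\<exists>N. \<forall>m\<ge>N. \<forall>n\<ge>N. vdist D (vadd D (X m) (Y m)) (vadd D (X n) (Y n)) < e" by blast
qed

lemma cauchy_seqs_vscale:
  assumes X: "X \<in> cauchy_seqs D"
  shows "(\<lambda>n. vscale D c (X n)) \<in> cauchy_seqs D"
  unfolding cauchy_seqs_def
proof (safe)
  fix n show "vscale D c (X n) \<in> carrier D"
    by (simp add: vspace_closed cauchy_seqs_carrier assms)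
next
  fix e :: real assume "e > 0"
  \<comment> \<open>Adding 1 keeps the denominator positive when \<open>c = 0\<close>.\<close>
  then have "0 < e / (cmod c + 1)" by (simp add: add_nonneg_pos)
  then obtain N where N: "\<forall>m\<ge>N. \<forall>n\<ge>N. vdist D (X m) (X n) < e / (cmod c + 1)"
    using cauchy_seqsD[OF X] by blast
  have "vdist D (vscale D c (X m)) (vscale D c (X n)) < e" if "m \<ge> N" "n \<ge> N" for m n
  proof -
    have "cmod c * vdist D (X m) (X n) \<le> (cmod c + 1) * vdist D (X m) (X n)"
      by (intro mult_right_mono vdist_nonneg cauchy_seqs_carrier assms) simp
    also have "\<dots> < e"
      using N that by (simp add: less_divide_eq add_nonneg_pos mult.commute)
    finally show ?thesis by (simp add: vdist_vscale cauchy_seqs_carrier assms)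
  qed
  then show "\<exists>N. \<forall>m\<ge>N. \<forall>n\<ge>N. vdist D (vscale D c (X m)) (vscale D c (X n)) < e" by blast
qed

text \<open>Allows a representative of a point of the completion to be replaced by a nearby sequence
  from a dense subset.\<close>

lemma cauchy_seqs_perturb:
  assumes X: "X \<in> cauchy_seqs D" and Y: "range Y \<subseteq> carrier D"
    and lim: "(\<lambda>n. vdist D (X n) (Y n)) \<longlonglongrightarrow> 0"
  shows "Y \<in> cauchy_seqs D"
  unfolding cauchy_seqs_def
proof (safe)
  fix n show "Y n \<in> carrier D" using Y by blast
next
  fix e :: real assume "e > 0"
  then have e: "0 < e / 3" by simp
  obtain M where M: "\<forall>m\<ge>M. \<forall>n\<ge>M. vdist D (X m) (X n) < e / 3"
    using cauchy_seqsD[OF X e] by blast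
  obtain N where N: "\<forall>n\<ge>N. norm (vdist D (X n) (Y n) - 0) < e / 3"
    using LIMSEQ_D[OF lim e] by blast
  have "vdist D (Y m) (Y n) < e" if "m \<ge> max M N" "n \<ge> max M N" for m n
  proof -
    have c: "X k \<in> carrier D" "Y k \<in> carrier D" for k
      using X Y by (auto simp: cauchy_seqs_carrier)
    have "vdist D (Y m) (Y n) \<le> vdist D (Y m) (X m) + (vdist D (X m) (X n) + vdist D (X n) (Y n))"
      using vdist_triangle[of "Y m" "X m" "Y n"] vdist_triangle[of "X m" "X n" "Y n"] c by simp
    moreover have "vdist D (X m) (X n) < e / 3" "vdist D (X m) (Y m) < e / 3" "vdist D (X n) (Y n) < e / 3"
      using M that N[rule_format, of m] N[rule_format, of n] by simp_all
    ultimately show ?thesis using vdist_commute[of "Y m" "X m"] c by simp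
  qed
  then show "\<exists>N. \<forall>m\<ge>N. \<forall>n\<ge>N. vdist D (Y m) (Y n) < e" by blast
qed

section \<open>Operations on the completion\<close>

lemma null_rel_iff: "(X, Y) \<in> null_rel D \<longleftrightarrow>
    X \<in> cauchy_seqs D \<and> Y \<in> cauchy_seqs D \<and> (\<lambda>n. vdist D (X n) (Y n)) \<longlonglongrightarrow> 0"
  by (auto simp: null_rel_def)

lemma null_relI:
  assumes "X \<in> cauchy_seqs D" "Y \<in> cauchy_seqs D" "\<And>n. vdist D (X n) (Y n) \<le> f n" "f \<longlonglongrightarrow> 0"
  shows "(X, Y) \<in> null_rel D"
proof -
  have "(\<lambda>n. vdist D (X n) (Y n)) \<longlonglongrightarrow> 0"
    by (rule tendsto_sandwich[OF _ _ tendsto_const assms(4)])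
      (simp_all add: assms vdist_nonneg cauchy_seqs_carrier)
  then show ?thesis using assms by (simp add: null_rel_iff)
qed

lemma equiv_null_rel: "equiv (cauchy_seqs D) (null_rel D)"
proof (rule equivI)
  show "null_rel D \<subseteq> cauchy_seqs D \<times> cauchy_seqs D" by (auto simp: null_rel_def)
  show "refl_on (cauchy_seqs D) (null_rel D)"
    by (auto simp: refl_on_def null_rel_iff vdist_refl cauchy_seqs_carrier)
  show "sym (null_rel D)"
    by (auto simp: sym_def null_rel_iff vdist_commute cauchy_seqs_carrier)
  show "trans (null_rel D)"
  proof (rule transI)
    fix X Y Z assume XY: "(X, Y) \<in> null_rel D" and YZ: "(Y, Z) \<in> null_rel D"
    show "(X, Z) \<in> null_rel D"
    proof (rule null_relI)
      show "vdist D (X n) (Z n) \<le> vdist D (X n) (Y n) + vdist D (Y n) (Z n)" for n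
        using XY YZ by (auto simp: null_rel_iff cauchy_seqs_carrier intro!: vdist_triangle)
      show "(\<lambda>n. vdist D (X n) (Y n) + vdist D (Y n) (Z n)) \<longlonglongrightarrow> 0"
        using XY YZ tendsto_add[of _ 0 _ _ 0] by (auto simp: null_rel_iff)
    qed (use XY YZ in \<open>auto simp: null_rel_iff\<close>)
  qed
qed

lemma class_eq_iff:
  assumes "X \<in> cauchy_seqs D" "Y \<in> cauchy_seqs D"
  shows "null_rel D `` {X} = null_rel D `` {Y} \<longleftrightarrow> (\<lambda>n. vdist D (X n) (Y n)) \<longlonglongrightarrow> 0"
  using assms eq_equiv_class_iff[OF equiv_null_rel assms] by (simp add: null_rel_iff)

lemma class_in_completion: "X \<in> cauchy_seqs D \<Longrightarrow> null_rel D `` {X} \<in> carrier (completion D)"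
  by (simp add: completion_def quotientI)

lemma completion_cases:
  assumes "P \<in> carrier (completion D)"
  obtains X where "X \<in> cauchy_seqs D" "P = null_rel D `` {X}"
  using assms by (auto simp: completion_def elim: quotientE)

text \<open>The union over representatives in \<open>completion\<close> collapses to one class,
  because null perturbations of the summands perturb the sum by a null sequence.\<close>

lemma vadd_completion:
  assumes "X \<in> cauchy_seqs D" "Y \<in> cauchy_seqs D"
  shows "vadd (completion D) (null_rel D `` {X}) (null_rel D `` {Y}) =
    null_rel D `` {\<lambda>n. vadd D (X n) (Y n)}"
proof -
  have "congruent2 (null_rel D) (null_rel D) (\<lambda>X Y. null_rel D `` {\<lambda>n. vadd D (X n) (Y n)})"
  proof (rule congruent2I', rule equiv_class_eq[OF equiv_null_rel])
    fix X X' Y Y' assume XX: "(X, X') \<in> null_rel D" and YY: "(Y, Y') \<in> null_rel D"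
    show "(\<lambda>n. vadd D (X n) (Y n), \<lambda>n. vadd D (X' n) (Y' n)) \<in> null_rel D"
    proof (rule null_relI)
      show "vdist D (vadd D (X n) (Y n)) (vadd D (X' n) (Y' n)) \<le> vdist D (X n) (X' n) + vdist D (Y n) (Y' n)" for n
        using XX YY by (auto simp: null_rel_iff cauchy_seqs_carrier intro!: vdist_vadd)
      show "(\<lambda>n. vdist D (X n) (X' n) + vdist D (Y n) (Y' n)) \<longlonglongrightarrow> 0"
        using XX YY tendsto_add[of _ 0 _ _ 0] by (auto simp: null_rel_iff)
    qed (use XX YY in \<open>auto simp: null_rel_iff cauchy_seqs_vadd\<close>)
  qed
  from UN_equiv_class2[OF equiv_null_rel equiv_null_rel this assms]
  show ?thesis by (simp add: completion_def)
qed

lemma vscale_completion: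
  assumes "X \<in> cauchy_seqs D"
  shows "vscale (completion D) c (null_rel D `` {X}) = null_rel D `` {\<lambda>n. vscale D c (X n)}"
proof -
  have "congruent (null_rel D) (\<lambda>X. null_rel D `` {\<lambda>n. vscale D c (X n)})"
  proof (rule congruentI, rule equiv_class_eq[OF equiv_null_rel])
    fix X X' assume XX: "(X, X') \<in> null_rel D"
    show "(\<lambda>n. vscale D c (X n), \<lambda>n. vscale D c (X' n)) \<in> null_rel D"
    proof (rule null_relI)
      show "vdist D (vscale D c (X n)) (vscale D c (X' n)) \<le> cmod c * vdist D (X n) (X' n)" for n
        using XX by (auto simp: null_rel_iff cauchy_seqs_carrier vdist_vscale)
      show "(\<lambda>n. cmod c * vdist D (X n) (X' n)) \<longlonglongrightarrow> 0"
        using XX tendsto_mult_right_zero by (auto simp: null_rel_iff)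
    qed (use XX in \<open>auto simp: null_rel_iff cauchy_seqs_vscale\<close>)
  qed
  from UN_equiv_class[OF equiv_null_rel this assms]
  show ?thesis by (simp add: completion_def)
qed

lemma vnorm_cauchy_bounded:
  assumes "X \<in> cauchy_seqs D"
  obtains B where "0 < B" "\<And>n. vnorm (X n) \<le> B"
proof -
  have "Cauchy (\<lambda>n. vnorm (X n))"
  proof (rule metric_CauchyI)
    fix e :: real assume "0 < e"
    then obtain N where N: "\<forall>m\<ge>N. \<forall>n\<ge>N. vdist D (X m) (X n) < e" using cauchy_seqsD[OF assms] by blast
    have "dist (vnorm (X m)) (vnorm (X n)) < e" if "m \<ge> N" "n \<ge> N" for m n
      using N that vnorm_diff_le[of "X m" "X n"] assms
      by (fastforce simp: dist_real_def cauchy_seqs_carrier)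
    then show "\<exists>N. \<forall>m\<ge>N. \<forall>n\<ge>N. dist (vnorm (X m)) (vnorm (X n)) < e" by blast
  qed
  then have "Bseq (\<lambda>n. vnorm (X n))" by (rule Cauchy_Bseq)
  then obtain B where B: "0 < B" "\<And>n. norm (vnorm (X n)) \<le> B" by (auto simp: Bseq_def)
  show thesis
    using B(2) by (intro that[OF B(1)]) (simp add: abs_le_iff)
qed

text \<open>Both sequences are norm-bounded, so \<open>ip_diff_le\<close> makes the inner products
  Cauchy in the complex numbers.\<close>

lemma ip_limit_exists:
  assumes X: "X \<in> cauchy_seqs D" and Y: "Y \<in> cauchy_seqs D"
  obtains z where "(\<lambda>n. ip D (X n) (Y n)) \<longlonglongrightarrow> z"
proof -
  obtain B where B: "0 < B" "\<And>n. vnorm (X n) \<le> B" using vnorm_cauchy_bounded[OF X] by blast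
  obtain C where C: "0 < C" "\<And>n. vnorm (Y n) \<le> C" using vnorm_cauchy_bounded[OF Y] by blast
  have "Cauchy (\<lambda>n. ip D (X n) (Y n))"
  proof (rule metric_CauchyI)
    fix e :: real assume e: "0 < e"
    obtain M where M: "\<forall>m\<ge>M. \<forall>n\<ge>M. vdist D (X m) (X n) < e / (2 * C)"
      using cauchy_seqsD[OF X, of "e / (2 * C)"] e C(1) by auto
    obtain N where N: "\<forall>m\<ge>N. \<forall>n\<ge>N. vdist D (Y m) (Y n) < e / (2 * B)"
      using cauchy_seqsD[OF Y, of "e / (2 * B)"] e B(1) by auto
    have "dist (ip D (X m) (Y m)) (ip D (X n) (Y n)) < e" if mn: "m \<ge> max M N" "n \<ge> max M N" for m n
    proof -
      have "vnorm (X m) * vdist D (Y m) (Y n) \<le> B * vdist D (Y m) (Y n)"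
        using B(2)[of m] X Y by (intro mult_right_mono) (auto simp: vdist_nonneg cauchy_seqs_carrier)
      also have "vdist D (Y m) (Y n) < e / (2 * B)" using N mn by simp
      then have "B * vdist D (Y m) (Y n) < e / 2"
        using B(1) by (simp add: less_divide_eq mult_ac)
      finally have 1: "vnorm (X m) * vdist D (Y m) (Y n) < e / 2" .
      have "vdist D (X m) (X n) * vnorm (Y n) \<le> vdist D (X m) (X n) * C"
        using C(2)[of n] X Y by (intro mult_left_mono) (auto simp: vdist_nonneg cauchy_seqs_carrier)
      also have "vdist D (X m) (X n) < e / (2 * C)" using M mn by simp
      then have "vdist D (X m) (X n) * C < e / 2"
        using C(1) by (simp add: less_divide_eq mult_ac)
      finally have 2: "vdist D (X m) (X n) * vnorm (Y n) < e / 2" .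
      show ?thesis
        using ip_diff_le[of "X m" "Y m" "X n" "Y n"] 1 2 X Y
        by (simp add: dist_norm cauchy_seqs_carrier)
    qed
    then show "\<exists>N. \<forall>m\<ge>N. \<forall>n\<ge>N. dist (ip D (X m) (Y m)) (ip D (X n) (Y n)) < e" by blast
  qed
  then show thesis using that by (auto simp: Cauchy_convergent_iff convergent_def)
qed

text \<open>Independence of representatives, which gives the \<open>THE\<close> in
  \<open>completion\<close> a unique solution.\<close>

lemma ip_limit_perturb:
  assumes XX: "(X, X') \<in> null_rel D" and YY: "(Y, Y') \<in> null_rel D"
    and lim: "(\<lambda>n. ip D (X n) (Y n)) \<longlonglongrightarrow> z"
  shows "(\<lambda>n. ip D (X' n) (Y' n)) \<longlonglongrightarrow> z"
proof -
  have c: "X n \<in> carrier D" "X' n \<in> carrier D" "Y n \<in> carrier D" "Y' n \<in> carrier D" for n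
    using XX YY by (auto simp: null_rel_iff cauchy_seqs_carrier)
  obtain B where B: "0 < B" "\<And>n. vnorm (X n) \<le> B"
    using vnorm_cauchy_bounded XX by (auto simp: null_rel_iff)
  obtain C where C: "0 < C" "\<And>n. vnorm (Y' n) \<le> C"
    using vnorm_cauchy_bounded YY by (auto simp: null_rel_iff)
  have "(\<lambda>n. ip D (X n) (Y n) - ip D (X' n) (Y' n)) \<longlonglongrightarrow> 0"
  proof (rule tendsto_norm_zero_cancel, rule tendsto_sandwich[OF _ _ tendsto_const])
    have "cmod (ip D (X n) (Y n) - ip D (X' n) (Y' n)) \<le>
        B * vdist D (Y n) (Y' n) + C * vdist D (X n) (X' n)" for n
    proof -
    have "vnorm (X n) * vdist D (Y n) (Y' n) \<le> B * vdist D (Y n) (Y' n)"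
      "vdist D (X n) (X' n) * vnorm (Y' n) \<le> C * vdist D (X n) (X' n)"
      using B(2)[of n] C(2)[of n] c
      by (auto intro!: mult_right_mono mult_left_mono simp: vdist_nonneg mult.commute)
    then show ?thesis
      using ip_diff_le[of "X n" "Y n" "X' n" "Y' n"] c by simp
    qed
    then show "\<forall>\<^sub>F n in sequentially. cmod (ip D (X n) (Y n) - ip D (X' n) (Y' n)) \<le>
        B * vdist D (Y n) (Y' n) + C * vdist D (X n) (X' n)"
      by simp
  next
    have "(\<lambda>n. B * vdist D (Y n) (Y' n) + C * vdist D (X n) (X' n)) \<longlonglongrightarrow> B * 0 + C * 0"
      using XX YY by (intro tendsto_intros) (auto simp: null_rel_iff)
    then show "(\<lambda>n. B * vdist D (Y n) (Y' n) + C * vdist D (X n) (X' n)) \<longlonglongrightarrow> 0" by simp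
  qed simp
  from tendsto_diff[OF lim this] show ?thesis by simp
qed

lemma ip_completion:
  assumes X: "X \<in> cauchy_seqs D" and Y: "Y \<in> cauchy_seqs D"
    and lim: "(\<lambda>n. ip D (X n) (Y n)) \<longlonglongrightarrow> z"
  shows "ip (completion D) (null_rel D `` {X}) (null_rel D `` {Y}) = z"
proof -
  have "(THE z. \<exists>X'\<in>null_rel D `` {X}. \<exists>Y'\<in>null_rel D `` {Y}. (\<lambda>n. ip D (X' n) (Y' n)) \<longlonglongrightarrow> z) = z"
  proof (rule the_equality)
    show "\<exists>X'\<in>null_rel D `` {X}. \<exists>Y'\<in>null_rel D `` {Y}. (\<lambda>n. ip D (X' n) (Y' n)) \<longlonglongrightarrow> z"
      using lim equiv_class_self[OF equiv_null_rel X] equiv_class_self[OF equiv_null_rel Y] by blast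
    fix w assume "\<exists>X'\<in>null_rel D `` {X}. \<exists>Y'\<in>null_rel D `` {Y}. (\<lambda>n. ip D (X' n) (Y' n)) \<longlonglongrightarrow> w"
    then obtain X' Y' where "(X, X') \<in> null_rel D" "(Y, Y') \<in> null_rel D" "(\<lambda>n. ip D (X' n) (Y' n)) \<longlonglongrightarrow> w"
      by auto
    then show "w = z" using LIMSEQ_unique[OF _ ip_limit_perturb[OF _ _ lim]] by blast
  qed
  then show ?thesis by (simp add: completion_def)
qed

lemma to_completion_in: "x \<in> carrier D \<Longrightarrow> to_completion D x \<in> carrier (completion D)"
  by (simp add: to_completion_def class_in_completion cauchy_seqs_const)

lemma ip_to_completion:
  "x \<in> carrier D \<Longrightarrow> y \<in> carrier D \<Longrightarrow> ip (completion D) (to_completion D x) (to_completion D y) = ip D x y"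
  unfolding to_completion_def by (intro ip_completion cauchy_seqs_const tendsto_const)

end


section \<open>Cocycles and their forms\<close>

lemma (in prehilbert_space) eq_if_ip_eq:
  assumes "x \<in> carrier D" "y \<in> carrier D" "\<And>z. z \<in> carrier D \<Longrightarrow> ip D x z = ip D y z"
  shows "x = y"
proof -
  have "ip D (vminus x y) (vminus x y) = 0"
    using assms by (simp add: vspace_closed ip_vadd_left ip_vscale_left)
  then have z: "vminus x y = vzero D"
    by (intro ip_definite vspace_closed assms)
  have "x = vadd D (vminus x y) y"
    using assms(1,2) by (metis vspace_closed vadd_assoc vadd_commute vadd_inverse_cancel)
  then show ?thesis using z assms by (simp add: vadd_zero)
qed

text \<open>What remains of a cocycle when its representation and the multiplicative identity are
  dropped; this much already decides unitary equivalence.\<close>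

locale dense_linear_map = prehilbert_space D
  for D :: "'h prehilbert" +
  fixes \<eta> :: "'a::complex_vector \<Rightarrow> 'h"
  assumes map_closed: "\<eta> a \<in> carrier D"
    and map_add: "\<eta> (a + b) = vadd D (\<eta> a) (\<eta> b)"
    and map_scaleC: "\<eta> (c *\<^sub>C a) = vscale D c (\<eta> a)"
    and map_dense: "dense_in D (range \<eta>)"
begin

lemma vdist_map: "vdist D (\<eta> a) (\<eta> b) = sqrt (Re (ip D (\<eta> (a - b)) (\<eta> (a - b))))"
proof -
  have "vminus (\<eta> a) (\<eta> b) = \<eta> (a + (-1) *\<^sub>C b)" by (simp only: map_add map_scaleC)
  also have "a + (-1) *\<^sub>C b = a - b" by simp
  finally show ?thesis by (simp add: vdist_def Let_def)
qed

text \<open>Density provides a point of the range within \<open>1 / Suc n\<close> of the n-th term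
  of any representative, a change by a null sequence.\<close>

lemma completion_cases_map:
  assumes "P \<in> carrier (completion D)"
  obtains a where "(\<lambda>n. \<eta> (a n)) \<in> cauchy_seqs D" "P = null_rel D `` {\<lambda>n. \<eta> (a n)}"
proof -
  obtain X where X: "X \<in> cauchy_seqs D" and P: "P = null_rel D `` {X}"
    using assms by (rule completion_cases)
  have "\<exists>a. vdist D (X n) (\<eta> a) < 1 / Suc n" for n
    using map_dense cauchy_seqs_carrier[OF X, of n] unfolding dense_in_def by fastforce
  then obtain a where a: "vdist D (X n) (\<eta> (a n)) < 1 / Suc n" for n by metis
  have lim: "(\<lambda>n. vdist D (X n) (\<eta> (a n))) \<longlonglongrightarrow> 0"
  proof (rule tendsto_sandwich[OF _ _ tendsto_const])
    show "(\<lambda>n. 1 / real (Suc n)) \<longlonglongrightarrow> 0"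
      using LIMSEQ_inverse_real_of_nat by (simp add: inverse_eq_divide)
    show "\<forall>\<^sub>F n in sequentially. 0 \<le> vdist D (X n) (\<eta> (a n))"
      by (simp add: vdist_nonneg cauchy_seqs_carrier[OF X] map_closed)
    show "\<forall>\<^sub>F n in sequentially. vdist D (X n) (\<eta> (a n)) \<le> 1 / real (Suc n)"
      using a by (intro always_eventually allI less_imp_le)
  qed
  have c: "(\<lambda>n. \<eta> (a n)) \<in> cauchy_seqs D"
    using X _ lim by (rule cauchy_seqs_perturb) (auto simp: map_closed)
  show thesis
    by (rule that[OF c]) (simp add: P class_eq_iff X c lim)
qed

end

text \<open>Equal forms induce equal distances on the domain, so both completions are described by
  the same sequences of elements of \<open>'a\<close>. The unitary sends the class of the
  \<eta>1-images of a sequence to the class of its \<eta>2-images.\<close>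

lemma unitarily_equivalent_if_ip_eq:
  assumes 1: "dense_linear_map D1 \<eta>1" and 2: "dense_linear_map D2 \<eta>2"
    and eq: "\<And>a b. ip D1 (\<eta>1 a) (\<eta>1 b) = ip D2 (\<eta>2 a) (\<eta>2 b)"
  shows "unitarily_equivalent (D1, \<eta>1) (D2, \<eta>2)"
proof -
  interpret D1: dense_linear_map D1 \<eta>1 by fact
  interpret D2: dense_linear_map D2 \<eta>2 by fact
  \<comment> \<open>The common index set: by \<open>C2\<close> the same sequences have Cauchy images
    under \<open>\<eta>2\<close>.\<close>
  define C where "C = {a. (\<lambda>n. \<eta>1 (a n)) \<in> cauchy_seqs D1}"
  define cls1 where "cls1 a = null_rel D1 `` {\<lambda>n. \<eta>1 (a n)}" for a
  define cls2 where "cls2 a = null_rel D2 `` {\<lambda>n. \<eta>2 (a n)}" for a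
  have vdist: "vdist D1 (\<eta>1 a) (\<eta>1 b) = vdist D2 (\<eta>2 a) (\<eta>2 b)" for a b
    by (simp add: D1.vdist_map D2.vdist_map eq)
  have C1: "a \<in> C \<longleftrightarrow> (\<lambda>n. \<eta>1 (a n)) \<in> cauchy_seqs D1" for a by (simp add: C_def)
  have C2: "a \<in> C \<longleftrightarrow> (\<lambda>n. \<eta>2 (a n)) \<in> cauchy_seqs D2" for a
    unfolding C_def cauchy_seqs_def using D1.map_closed D2.map_closed by (auto simp: vdist)
  have eq_iff: "cls1 a = cls1 b \<longleftrightarrow> cls2 a = cls2 b" if "a \<in> C" "b \<in> C" for a b
    unfolding cls1_def cls2_def
    using that D1.class_eq_iff[of "\<lambda>n. \<eta>1 (a n)" "\<lambda>n. \<eta>1 (b n)"]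
      D2.class_eq_iff[of "\<lambda>n. \<eta>2 (a n)" "\<lambda>n. \<eta>2 (b n)"]
    by (simp add: vdist flip: C1 C2)
  have car1: "carrier (completion D1) = cls1 ` C"
    by (auto simp: cls1_def C1 intro: D1.class_in_completion elim: D1.completion_cases_map)
  have car2: "carrier (completion D2) = cls2 ` C"
    by (auto simp: cls2_def C2 intro: D2.class_in_completion elim: D2.completion_cases_map)
  have add: "(\<lambda>n. a n + b n) \<in> C" and add1: "vadd (completion D1) (cls1 a) (cls1 b) = cls1 (\<lambda>n. a n + b n)"
    and add2: "vadd (completion D2) (cls2 a) (cls2 b) = cls2 (\<lambda>n. a n + b n)" if "a \<in> C" "b \<in> C" for a b
  proof -
    show "(\<lambda>n. a n + b n) \<in> C"
      using D1.cauchy_seqs_vadd that by (simp add: C1 D1.map_add)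
    show "vadd (completion D1) (cls1 a) (cls1 b) = cls1 (\<lambda>n. a n + b n)"
      using that by (simp add: C1 cls1_def D1.map_add D1.vadd_completion)
    show "vadd (completion D2) (cls2 a) (cls2 b) = cls2 (\<lambda>n. a n + b n)"
      using that by (simp add: C2 cls2_def D2.map_add D2.vadd_completion)
  qed
  have scale: "(\<lambda>n. c *\<^sub>C a n) \<in> C" and scale1: "vscale (completion D1) c (cls1 a) = cls1 (\<lambda>n. c *\<^sub>C a n)"
    and scale2: "vscale (completion D2) c (cls2 a) = cls2 (\<lambda>n. c *\<^sub>C a n)" if "a \<in> C" for a c
  proof -
    show "(\<lambda>n. c *\<^sub>C a n) \<in> C"
      using D1.cauchy_seqs_vscale that by (simp add: C1 D1.map_scaleC)
    show "vscale (completion D1) c (cls1 a) = cls1 (\<lambda>n. c *\<^sub>C a n)"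
      using that by (simp add: C1 cls1_def D1.map_scaleC D1.vscale_completion)
    show "vscale (completion D2) c (cls2 a) = cls2 (\<lambda>n. c *\<^sub>C a n)"
      using that by (simp add: C2 cls2_def D2.map_scaleC D2.vscale_completion)
  qed
  have ip: "ip (completion D2) (cls2 a) (cls2 b) = ip (completion D1) (cls1 a) (cls1 b)"
    if ab: "a \<in> C" "b \<in> C" for a b
  proof -
    obtain z where z: "(\<lambda>n. ip D1 (\<eta>1 (a n)) (\<eta>1 (b n))) \<longlonglongrightarrow> z"
      using D1.ip_limit_exists ab unfolding C1 by blast
    have "ip (completion D1) (cls1 a) (cls1 b) = z"
      using ab z unfolding C1 cls1_def by (rule D1.ip_completion)
    moreover have "ip (completion D2) (cls2 a) (cls2 b) = z"
      using ab z unfolding C2 cls2_def eq by (rule D2.ip_completion)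
    ultimately show ?thesis by simp
  qed
  \<comment> \<open>Any representing sequence will do, since \<open>eq_iff\<close> makes
    \<open>cls2\<close> depend only on \<open>cls1\<close>; the same equivalence gives
    injectivity.\<close>
  define U where "U P = cls2 (SOME a. a \<in> C \<and> P = cls1 a)" for P
  have U: "U (cls1 a) = cls2 a" if "a \<in> C" for a
  proof -
    have "\<exists>b. b \<in> C \<and> cls1 a = cls1 b" using that by blast
    from someI_ex[OF this] show ?thesis unfolding U_def using that eq_iff by metis
  qed
  have "unitary_between (completion D1) (completion D2) U"
    unfolding unitary_between_def linear_between_def car1 car2 bij_betw_def inj_on_def
    using U eq_iff by (auto simp: add add1 add2 scale scale1 scale2 ip)
  moreover have "to_completion D2 (\<eta>2 a) = U (to_completion D1 (\<eta>1 a))" for a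
  proof -
    have "(\<lambda>n. a) \<in> C" by (simp add: C1 D1.cauchy_seqs_const D1.map_closed)
    from U[OF this] show ?thesis by (simp add: cls1_def cls2_def to_completion_def)
  qed
  ultimately show ?thesis unfolding unitarily_equivalent_def by blast
qed

lemma unitarily_equivalent_iff_ip_eq:
  assumes "dense_linear_map D1 \<eta>1" "dense_linear_map D2 \<eta>2"
  shows "unitarily_equivalent (D1, \<eta>1) (D2, \<eta>2) \<longleftrightarrow>
    (\<forall>a b. ip D1 (\<eta>1 a) (\<eta>1 b) = ip D2 (\<eta>2 a) (\<eta>2 b))"
proof
  interpret D1: dense_linear_map D1 \<eta>1 by fact
  interpret D2: dense_linear_map D2 \<eta>2 by fact
  assume "unitarily_equivalent (D1, \<eta>1) (D2, \<eta>2)"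
  then obtain U where U: "unitary_between (completion D1) (completion D2) U"
    and c: "\<And>a. to_completion D2 (\<eta>2 a) = U (to_completion D1 (\<eta>1 a))"
    by (auto simp: unitarily_equivalent_def)
  show "\<forall>a b. ip D1 (\<eta>1 a) (\<eta>1 b) = ip D2 (\<eta>2 a) (\<eta>2 b)"
  proof (intro allI)
    fix a b
    have "ip D2 (\<eta>2 a) (\<eta>2 b) = ip (completion D2) (U (to_completion D1 (\<eta>1 a))) (U (to_completion D1 (\<eta>1 b)))"
      by (simp add: D2.ip_to_completion D2.map_closed flip: c)
    also have "\<dots> = ip D1 (\<eta>1 a) (\<eta>1 b)"
      using U by (simp add: unitary_between_def D1.to_completion_in D1.ip_to_completion D1.map_closed)
    finally show "ip D1 (\<eta>1 a) (\<eta>1 b) = ip D2 (\<eta>2 a) (\<eta>2 b)" by simp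
  qed
qed (use assms in \<open>auto intro: unitarily_equivalent_if_ip_eq\<close>)

text \<open>The quotient by the null vectors of \<phi>, realised by one chosen representative per
  class and carried into the universe \<open>'h\<close> by \<open>j\<close>.\<close>

lemma gns_quotient:
  fixes \<phi> :: "'a::complex_vector \<Rightarrow> 'a \<Rightarrow> complex" and j :: "'a \<Rightarrow> 'h"
  assumes j: "inj j"
    and add: "\<And>a b c. \<phi> a (b + c) = \<phi> a b + \<phi> a c"
    and scale: "\<And>a b c. \<phi> a (c *\<^sub>C b) = c * \<phi> a b"
    and herm: "\<And>a b. \<phi> b a = cnj (\<phi> a b)"
    and nonneg: "\<And>a. \<phi> a a \<in> \<real>\<^sub>\<ge>\<^sub>0"
  obtains D :: "'h prehilbert" and \<eta> where "dense_linear_map D \<eta>" "carrier D = range \<eta>"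
    "\<And>a b. ip D (\<eta> a) (\<eta> b) = \<phi> a b"
proof -
  \<comment> \<open>\<open>inv \<phi> (\<phi> a)\<close> depends only on the functional
    \<open>\<phi> a\<close>, so it picks one element among all those inducing that functional.
    Below, \<open>\<kappa>\<close> reads it back from \<open>'h\<close>.\<close>
  define \<eta> where "\<eta> a = j (inv \<phi> (\<phi> a))" for a
  define \<kappa> where "\<kappa> = inv j"
  have \<kappa>: "\<phi> (\<kappa> (\<eta> a)) = \<phi> a" for a
    by (simp add: \<kappa>_def \<eta>_def inv_f_f[OF j] f_inv_into_f)
  have \<eta>: "\<eta> a = \<eta> b" if "\<phi> a = \<phi> b" for a b
    by (simp add: \<eta>_def that)
  have add': "\<phi> (a + b) c = \<phi> a c + \<phi> b c" and scale': "\<phi> (k *\<^sub>C a) c = cnj k * \<phi> a c" for a b c k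
    using add[of c a b] scale[of c k a] herm by (metis complex_cnj_add complex_cnj_mult)+
  have \<kappa>2: "\<phi> a (\<kappa> (\<eta> b)) = \<phi> a b" for a b
    by (metis \<kappa> herm)
  have eq_add: "\<eta> (\<kappa> (\<eta> a) + \<kappa> (\<eta> b)) = \<eta> (a + b)" for a b
    by (rule \<eta>) (simp add: fun_eq_iff add' \<kappa>)
  have eq_scale: "\<eta> (c *\<^sub>C \<kappa> (\<eta> a)) = \<eta> (c *\<^sub>C a)" for a c
    by (rule \<eta>) (simp add: fun_eq_iff scale' \<kappa>)
  have definite: "\<eta> a = \<eta> 0" if "\<phi> a a = 0" for a
  proof (rule \<eta>, rule ext)
    fix b
    \<comment> \<open>Cauchy-Schwarz for the semidefinite form: a vector of length zero is
      orthogonal to everything, so it induces the functional of 0.\<close>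
    have "(cmod (\<phi> b a))\<^sup>2 \<le> Re (\<phi> b b) * 0"
    proof (rule hermitian_quadratic_discriminant)
      fix c
      have "\<phi> (b + c *\<^sub>C a) (b + c *\<^sub>C a) = \<phi> b b + (c * \<phi> b a + cnj (c * \<phi> b a))"
        by (simp add: add add' scale scale' that herm[of a b])
      then have "\<phi> (b + c *\<^sub>C a) (b + c *\<^sub>C a) = \<phi> b b + of_real (2 * Re (c * \<phi> b a))"
        by (simp only: complex_add_cnj)
      then show "0 \<le> Re (\<phi> b b) + 2 * Re (c * \<phi> b a) + (cmod c)\<^sup>2 * 0"
        using nonneg[of "b + c *\<^sub>C a"] by (simp add: complex_nonneg_Reals_iff)
    qed simp
    then have "\<phi> a b = 0" by (simp add: herm[of a b])
    then show "\<phi> a b = \<phi> 0 b" using scale'[of 0 a b] by simp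
  qed
  define D where "D = \<lparr>carrier = range \<eta>, vadd = \<lambda>x y. \<eta> (\<kappa> x + \<kappa> y), vzero = \<eta> 0,
    vscale = \<lambda>c x. \<eta> (c *\<^sub>C \<kappa> x), ip = \<lambda>x y. \<phi> (\<kappa> x) (\<kappa> y)\<rparr>"
  have D: "carrier D = range \<eta>" "vzero D = \<eta> 0" "vadd D (\<eta> a) (\<eta> b) = \<eta> (a + b)"
    "vscale D c (\<eta> a) = \<eta> (c *\<^sub>C a)" "ip D (\<eta> a) (\<eta> b) = \<phi> a b" for a b c
    by (simp_all add: D_def eq_add eq_scale \<kappa> \<kappa>2)
  have pre: "prehilbert_space D"
    by unfold_locales
      (auto simp: D add scale nonneg scaleC_add_left scaleC_add_right add.assoc add.commute add.left_commute
        intro: herm definite)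
  have "dense_linear_map D \<eta>"
  proof (intro dense_linear_map.intro[OF pre] dense_linear_map_axioms.intro)
    show "dense_in D (range \<eta>)"
      unfolding dense_in_def D(1)[symmetric]
      using prehilbert_space.vdist_refl[OF pre] by (metis order_refl)
  qed (simp_all add: D)
  then show thesis using D(1,5) by (rule that)
qed

section \<open>From a generating functional to a cocycle\<close>

lemma dense_linear_map_cocycle: "cocycle \<epsilon> D \<eta> \<Longrightarrow> dense_linear_map D \<eta>"
  by (simp add: cocycle_def dense_linear_map_def dense_linear_map_axioms_def)

text \<open>The coboundary identity solved for the inner product of \<open>\<eta> a\<close> and
  \<open>\<eta> b\<close>, so that \<open>yields_coboundary\<close> says that the form of \<eta> is
  this one.\<close>

definition generator_form ::
    "('a::complex_star_algebra \<Rightarrow> complex) \<Rightarrow> ('a \<Rightarrow> complex) \<Rightarrow> 'a \<Rightarrow> 'a \<Rightarrow> complex"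
  where "generator_form \<epsilon> L a b = L (star a * b) - cnj (\<epsilon> a) * L b - L (star a) * \<epsilon> b"

context hopf_star_algebra
begin

text \<open>The centred factors lie in the kernel of \<epsilon>; this is the shape in which
  positivity of \<open>L\<close> and adjointness of left multiplication apply.\<close>

lemma generator_form_centred:
  assumes L: "clinear L" "L 1 = 0"
  shows "generator_form \<epsilon> L a b = L (star (a - \<epsilon> a *\<^sub>C 1) * (b - \<epsilon> b *\<^sub>C 1))"
proof -
  have c: "star (a - \<epsilon> a *\<^sub>C 1) = star a - cnj (\<epsilon> a) *\<^sub>C 1"
    using star_add[of "a - \<epsilon> a *\<^sub>C 1" "\<epsilon> a *\<^sub>C 1"] by (simp add: star_scaleC algebra_simps)
  have "star (a - \<epsilon> a *\<^sub>C 1) * (b - \<epsilon> b *\<^sub>C 1) =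
      star a * b - cnj (\<epsilon> a) *\<^sub>C b - \<epsilon> b *\<^sub>C star a + (cnj (\<epsilon> a) * \<epsilon> b) *\<^sub>C 1"
    unfolding c by (simp add: algebra_simps mult_scaleC_left mult_scaleC_right)
  then show ?thesis
    by (simp add: generator_form_def clinear_add[OF L(1)] clinear_diff[OF L(1)] clinear_scaleC[OF L(1)] L(2))
qed

lemma generator_form_coboundary:
  "L (a * b) = \<epsilon> a * L b + L a * \<epsilon> b + generator_form \<epsilon> L (star a) b"
  by (simp add: generator_form_def counit_star)

text \<open>The representation is left multiplication on the kernel of \<epsilon>, passed to the
  quotient.\<close>

lemma cocycle_of_generator:
  assumes L: "generating_functional \<epsilon> L" and map: "dense_linear_map D \<eta>"
    and surj: "carrier D = range \<eta>"
    and ip: "\<And>a b. ip D (\<eta> a) (\<eta> b) = generator_form \<epsilon> L a b"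
  shows "cocycle \<epsilon> D \<eta>"
proof -
  interpret dense_linear_map D \<eta> by fact
  have lin: "clinear L" and one: "L 1 = 0" using L by (auto simp: generating_functional_def)
  \<comment> \<open>Left multiplication by \<open>a\<close> after projecting \<open>b\<close> to the
    kernel of \<epsilon>, where the product stays.\<close>
  define \<rho> where "\<rho> a b = a * (b - \<epsilon> b *\<^sub>C 1)" for a b
  have counit_centred: "\<epsilon> (b - \<epsilon> b *\<^sub>C 1) = 0" for b
    by (simp add: clinear_diff[OF counit_linear] clinear_scaleC[OF counit_linear] counit_one)
  have \<rho>0: "\<epsilon> (\<rho> a b) = 0" for a b
    by (simp add: \<rho>_def counit_mult counit_centred)
  have adj: "ip D (\<eta> (\<rho> a b)) (\<eta> c) = ip D (\<eta> b) (\<eta> (\<rho> (star a) c))" for a b c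
    by (simp add: ip generator_form_centred[OF lin one] \<rho>0)
      (simp add: \<rho>_def star_mult mult.assoc)
  define \<pi> where "\<pi> a x = \<eta> (\<rho> a (inv \<eta> x))" for a x
  \<comment> \<open>The preimage chosen by \<open>inv \<eta>\<close> does not matter: by
    \<open>adj\<close>, inner products with \<open>\<eta> (\<rho> a b)\<close> depend on
    \<open>b\<close> only through \<open>\<eta> b\<close>.\<close>
  have \<pi>: "\<pi> a (\<eta> b) = \<eta> (\<rho> a b)" for a b
    unfolding \<pi>_def
  proof (rule eq_if_ip_eq)
    fix z assume "z \<in> carrier D"
    then obtain c where "z = \<eta> c" by (auto simp: surj)
    then show "ip D (\<eta> (\<rho> a (inv \<eta> (\<eta> b)))) z = ip D (\<eta> (\<rho> a b)) z"
      by (simp add: adj f_inv_into_f)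
  qed (simp_all add: map_closed)
  have lin_\<rho>: "\<rho> a (b + c) = \<rho> a b + \<rho> a c" "\<rho> a (k *\<^sub>C b) = k *\<^sub>C \<rho> a b"
    "\<rho> (a + b) c = \<rho> a c + \<rho> b c" "\<rho> (k *\<^sub>C a) b = k *\<^sub>C \<rho> a b" for a b c k
    by (simp_all add: \<rho>_def clinear_add[OF counit_linear] clinear_scaleC[OF counit_linear]
        scaleC_add_left complex_vector.scale_right_diff_distrib mult_scaleC_left mult_scaleC_right
        algebra_simps)
  have mult_\<rho>: "\<rho> (a * b) c = \<rho> a (\<rho> b c)" for a b c
    unfolding \<rho>_def[of a "\<rho> b c"] by (simp add: \<rho>0) (simp add: \<rho>_def mult.assoc)
  have lb: "linear_between D D (\<pi> a)" for a
    unfolding linear_between_def surj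
    by (auto simp: \<pi> lin_\<rho> simp flip: map_add map_scaleC)
  have ad: "is_adjoint D (\<pi> a) (\<pi> (star a))" for a
    unfolding is_adjoint_def surj by (auto simp: \<pi> adj)
  have \<eta>1: "\<eta> (\<rho> 1 b) = \<eta> b" for b
  proof (rule eq_if_ip_eq)
    fix z assume "z \<in> carrier D"
    then obtain c where "z = \<eta> c" by (auto simp: surj)
    then show "ip D (\<eta> (\<rho> 1 b)) z = ip D (\<eta> b) z"
      by (simp add: ip generator_form_centred[OF lin one] \<rho>0) (simp add: \<rho>_def)
  qed (simp_all add: map_closed)
  have "representation D \<pi>"
    unfolding representation_def adjointable_ops_def
  proof (intro conjI allI ballI)
    fix a show "\<pi> a \<in> {T. linear_between D D T \<and> (\<exists>T'. linear_between D D T' \<and> is_adjoint D T T')}"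
      using lb ad by blast
  qed (auto simp: surj \<pi> lin_\<rho> mult_\<rho> map_add map_scaleC ad \<eta>1)
  \<comment> \<open>The image under \<eta> of the decomposition
    \<open>a * b = \<rho> a b + \<epsilon> b *\<^sub>C a\<close>.\<close>
  moreover have "\<eta> (a * b) = vadd D (\<pi> a (\<eta> b)) (vscale D (\<epsilon> b) (\<eta> a))" for a b
    by (simp add: \<pi> \<rho>_def algebra_simps mult_scaleC_right flip: map_add map_scaleC)
  ultimately show ?thesis
    unfolding cocycle_def
    using prehilbert_space_axioms map_closed map_add map_scaleC map_dense by blast
qed

end


section \<open>The correspondence\<close>

lemma bialgebra_automorphism_admissible:
  fixes \<Delta> :: "'a::complex_star_algebra \<Rightarrow> ('a, 'a) tensor"
  assumes "hopf_star_algebra \<Delta> \<epsilon> S" and \<alpha>: "admissible_bijection \<Delta> \<alpha>"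
  shows "bialgebra_automorphism \<Delta> \<epsilon> S \<alpha>"
proof -
  have hom: "algebra_hom \<alpha>" and star: "\<alpha> \<circ> star \<circ> \<alpha> \<circ> star = id"
    and comult: "tensor_map \<alpha> \<alpha> \<circ> \<Delta> = \<Delta> \<circ> \<alpha>"
    using \<alpha> by (simp_all add: admissible_bijection_def)
  show ?thesis
  proof (intro bialgebra_automorphism.intro bialgebra_automorphism_axioms.intro assms(1))
    show "\<Delta> (\<alpha> a) = tensor_map \<alpha> \<alpha> (\<Delta> a)" for a
      using fun_cong[OF comult, of a] by simp
    show "\<alpha> (star (\<alpha> (star a))) = a" for a
      using fun_cong[OF star, of a] by simp
  qed (use hom in \<open>simp_all add: algebra_hom_def\<close>)
qed

lemma real_cocycle_of_generator:
  fixes \<Delta> :: "'a::complex_star_algebra \<Rightarrow> ('a, 'a) tensor"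
  assumes "bialgebra_automorphism \<Delta> \<epsilon> S \<alpha>" and j: "inj (j :: 'a \<Rightarrow> 'h)"
    and L: "L \<in> invariant_generating_functionals \<epsilon> (S \<circ> \<alpha>)"
  obtains D :: "'h prehilbert" and \<eta> where "(D, \<eta>) \<in> real_cocycles \<epsilon> (S \<circ> \<alpha>)"
    "\<And>a b. ip D (\<eta> a) (\<eta> b) = generator_form \<epsilon> L a b"
proof -
  interpret bialgebra_automorphism \<Delta> \<epsilon> S \<alpha> by fact
  have gen: "generating_functional \<epsilon> L" and inv: "L (S (\<alpha> a)) = L a" for a
    using L by (auto simp: invariant_generating_functionals_def fun_eq_iff)
  have lin: "clinear L" and one: "L 1 = 0" and herm: "L (star a) = cnj (L a)"
    and pos: "\<epsilon> a = 0 \<Longrightarrow> L (star a * a) \<in> \<real>\<^sub>\<ge>\<^sub>0" for a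
    using gen by (auto simp: generating_functional_def)
  have 1: "generator_form \<epsilon> L a (b + c) = generator_form \<epsilon> L a b + generator_form \<epsilon> L a c" for a b c
    by (simp add: generator_form_def clinear_add[OF lin] clinear_add[OF counit_linear] distrib_left)
  have 2: "generator_form \<epsilon> L a (c *\<^sub>C b) = c * generator_form \<epsilon> L a b" for a b c
    by (simp add: generator_form_def clinear_scaleC[OF lin] clinear_scaleC[OF counit_linear]
        mult_scaleC_right algebra_simps)
  have 3: "generator_form \<epsilon> L b a = cnj (generator_form \<epsilon> L a b)" for a b
    using herm[of "star a * b"] by (simp add: generator_form_def herm star_mult algebra_simps)
  have 4: "generator_form \<epsilon> L a a \<in> \<real>\<^sub>\<ge>\<^sub>0" for a
    unfolding generator_form_centred[OF lin one]
    by (rule pos) (simp add: clinear_diff[OF counit_linear] clinear_scaleC[OF counit_linear] counit_one)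
  obtain D :: "'h prehilbert" and \<eta> where D: "dense_linear_map D \<eta>" "carrier D = range \<eta>"
    "\<And>a b. ip D (\<eta> a) (\<eta> b) = generator_form \<epsilon> L a b"
    using gns_quotient[of j "generator_form \<epsilon> L", OF j 1 2 3 4] by blast
  \<comment> \<open>Reality: \<open>S \<circ> \<alpha>\<close> reverses products and leaves both
    \<open>L\<close> and \<epsilon> invariant.\<close>
  have "generator_form \<epsilon> L a b = generator_form \<epsilon> L (star (S (\<alpha> b))) (S (\<alpha> (star a)))" for a b
  proof -
    have "S (\<alpha> b) * S (\<alpha> (star a)) = S (\<alpha> (star a * b))"
      by (simp add: aut_mult antipode_mult)
    then show ?thesis
      by (simp add: generator_form_def inv counit_star counit_antipode counit_aut algebra_simps)
  qed
  then have "(D, \<eta>) \<in> real_cocycles \<epsilon> (S \<circ> \<alpha>)"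
    using cocycle_of_generator[OF gen D] by (simp add: real_cocycles_def D(3))
  then show thesis using D(3) by (rule that)
qed

text \<open>The form of \<eta>, with a star in its first argument, satisfies all hypotheses of
  \<open>invariant_coboundary_exists\<close>; positivity of the resulting \<open>L\<close> comes
  from the inner product.\<close>

lemma generator_of_real_cocycle:
  fixes \<Delta> :: "'a::complex_star_algebra \<Rightarrow> ('a, 'a) tensor"
  assumes "bialgebra_automorphism \<Delta> \<epsilon> S \<alpha>"
    and bij: "bij (\<lambda>a. a + \<alpha> a)"
    and surj: "surj (\<lambda>t. tensor_map id id t + tensor_map \<alpha> \<alpha> t)"
    and D: "(D, \<eta>) \<in> real_cocycles \<epsilon> (S \<circ> \<alpha>)"
  obtains L where "L \<in> invariant_generating_functionals \<epsilon> (S \<circ> \<alpha>)"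
    "\<And>a b. ip D (\<eta> a) (\<eta> b) = generator_form \<epsilon> L a b"
proof -
  interpret bialgebra_automorphism \<Delta> \<epsilon> S \<alpha> by fact
  have cocycle: "cocycle \<epsilon> D \<eta>"
    and real: "ip D (\<eta> a) (\<eta> b) = ip D (\<eta> (star (S (\<alpha> b)))) (\<eta> (S (\<alpha> (star a))))" for a b
    using D by (auto simp: real_cocycles_def)
  interpret dense_linear_map D \<eta> by (rule dense_linear_map_cocycle[OF cocycle])
  obtain \<pi> where \<pi>: "representation D \<pi>"
    and \<eta>_mult: "\<And>a b. \<eta> (a * b) = vadd D (\<pi> a (\<eta> b)) (vscale D (\<epsilon> b) (\<eta> a))"
    using cocycle by (auto simp: cocycle_def)
  have \<pi>_closed: "\<pi> a (\<eta> b) \<in> carrier D" for a b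
  proof -
    have "linear_between D D (\<pi> a)" using \<pi> by (simp add: representation_def adjointable_ops_def)
    then show ?thesis using map_closed by (auto simp: linear_between_def)
  qed
  have adj: "ip D (\<pi> (star a) (\<eta> b)) (\<eta> c) = ip D (\<eta> b) (\<pi> a (\<eta> c))" for a b c
    using \<pi> map_closed by (auto simp: representation_def is_adjoint_def)
  define \<psi> where "\<psi> a b = ip D (\<eta> (star a)) (\<eta> b)" for a b
  have bil: "cbilinear \<psi>"
    by (simp add: semi_bilinear_def \<psi>_def star_add star_scaleC map_add map_scaleC ip_simps map_closed vspace_closed)
  \<comment> \<open>The operator \<open>\<pi> (star b)\<close> from the first argument moves across
    the inner product as \<open>\<pi> b\<close>, and \<open>\<eta>_mult\<close> rewrites the result
    as the image of \<open>b * c\<close>.\<close>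
  have cocyc: "\<psi> (a * b) c = \<psi> a (b * c) - \<epsilon> c * \<psi> a b + \<epsilon> a * \<psi> b c" for a b c
    by (simp add: \<psi>_def star_mult \<eta>_mult ip_simps \<pi>_closed map_closed vspace_closed adj counit_star)
  have "\<psi> 1 1 = 0"
  proof -
    have "\<pi> 1 (\<eta> 1) = \<eta> 1" using \<pi> map_closed by (simp add: representation_def)
    \<comment> \<open>The cocycle identity at \<open>1 * 1\<close> doubles \<open>\<eta> 1\<close>,
      hence \<open>\<psi> 1 1\<close> equals its own double.\<close>
    then have "\<eta> (1 * 1) = \<eta> (1 + 1)"
      unfolding \<eta>_mult map_add by (simp add: counit_one vscale_one map_closed)
    then have "\<psi> 1 1 = \<psi> 1 (1 + 1)" by (simp only: \<psi>_def mult_1)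
    also have "\<dots> = \<psi> 1 1 + \<psi> 1 1" using bil unfolding semi_bilinear_def by blast
    finally show ?thesis by simp
  qed
  then have one: "\<psi> 1 c = 0" for c
    using cocyc[of 1 1 c] by (simp add: counit_one)
  have real': "\<psi> a b = \<psi> (S (\<alpha> b)) (S (\<alpha> a))" for a b
    using real[of "star a" b] by (simp add: \<psi>_def)
  have herm: "cnj (\<psi> a b) = \<psi> (star b) (star a)" for a b
    by (simp add: \<psi>_def map_closed flip: ip_cnj)
  obtain L where L: "clinear L" "L 1 = 0" "\<And>a. L (S (\<alpha> a)) = L a"
    "\<And>a b. L (a * b) = \<epsilon> a * L b + L a * \<epsilon> b + \<psi> a b" "\<And>a. L (star a) = cnj (L a)"
    using invariant_coboundary_exists[OF bij surj bil cocyc one real' herm] by blast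
  have "L (star a * a) \<in> \<real>\<^sub>\<ge>\<^sub>0" if "\<epsilon> a = 0" for a
    using that ip_nonneg[OF map_closed] by (simp add: L(4) counit_star \<psi>_def)
  then have "L \<in> invariant_generating_functionals \<epsilon> (S \<circ> \<alpha>)"
    using L by (simp add: invariant_generating_functionals_def generating_functional_def fun_eq_iff)
  moreover have "ip D (\<eta> a) (\<eta> b) = generator_form \<epsilon> L a b" for a b
    by (simp add: generator_form_def L(4) counit_star \<psi>_def)
  ultimately show thesis by (rule that)
qed

text \<open>Equal forms mean equal coboundaries, and the uniqueness result for invariant functionals
  applies.\<close>

lemma generator_form_inj:
  fixes \<Delta> :: "'a::complex_star_algebra \<Rightarrow> ('a, 'a) tensor"
  assumes "bialgebra_automorphism \<Delta> \<epsilon> S \<alpha>" and surj: "surj (\<lambda>a. a + \<alpha> a)"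
  shows "inj_on (generator_form \<epsilon>) (invariant_generating_functionals \<epsilon> (S \<circ> \<alpha>))"
proof (rule inj_onI)
  interpret bialgebra_automorphism \<Delta> \<epsilon> S \<alpha> by fact
  fix L M
  assume L: "L \<in> invariant_generating_functionals \<epsilon> (S \<circ> \<alpha>)"
    and M: "M \<in> invariant_generating_functionals \<epsilon> (S \<circ> \<alpha>)"
    and eq: "generator_form \<epsilon> L = generator_form \<epsilon> M"
  note defs = invariant_generating_functionals_def generating_functional_def
  show "L = M"
  proof (rule invariant_coboundary_unique[OF surj, where \<psi> = "\<lambda>a b. generator_form \<epsilon> L (star a) b"])
    show "M (a * b) = \<epsilon> a * M b + M a * \<epsilon> b + generator_form \<epsilon> L (star a) b" for a b
      unfolding eq by (rule generator_form_coboundary)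
  qed (use L M generator_form_coboundary in \<open>auto simp: defs fun_eq_iff\<close>)
qed

theorem theorem2p8:
  fixes \<Delta> :: "'a::complex_star_algebra \<Rightarrow> ('a, 'a) tensor"
    and \<epsilon> :: "'a \<Rightarrow> complex"
    and S \<alpha> :: "'a \<Rightarrow> 'a"
  assumes "hopf_star_algebra \<Delta> \<epsilon> S"
    and "admissible_bijection \<Delta> \<alpha>"
    and universe: "\<exists>j :: 'a \<Rightarrow> 'h. inj j"
  shows "\<exists>\<Phi> :: ('a \<Rightarrow> complex) \<Rightarrow> ('h prehilbert \<times> ('a \<Rightarrow> 'h)) set.
    bij_betw \<Phi> (invariant_generating_functionals \<epsilon> (S \<circ> \<alpha>)) (real_cocycle_classes \<epsilon> (S \<circ> \<alpha>)) \<and>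
    (\<forall>L \<in> invariant_generating_functionals \<epsilon> (S \<circ> \<alpha>). \<forall>(D, \<eta>) \<in> \<Phi> L. yields_coboundary \<epsilon> D \<eta> L)"
proof -
  have aut: "bialgebra_automorphism \<Delta> \<epsilon> S \<alpha>"
    by (rule bialgebra_automorphism_admissible) fact+
  interpret bialgebra_automorphism \<Delta> \<epsilon> S \<alpha> by fact
  have bij: "bij (\<lambda>a. a + \<alpha> a)"
    and surj: "surj (\<lambda>t. tensor_map id id t + tensor_map \<alpha> \<alpha> t)"
    using assms(2) by (auto simp: admissible_bijection_def bij_is_surj)
  obtain j :: "'a \<Rightarrow> 'h" where j: "inj j" using universe by blast
  define I where "I = invariant_generating_functionals \<epsilon> (S \<circ> \<alpha>)"
  define R :: "('h prehilbert \<times> ('a \<Rightarrow> 'h)) set" where "R = real_cocycles \<epsilon> (S \<circ> \<alpha>)"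
  define form where "form = (\<lambda>(D :: 'h prehilbert, \<eta> :: 'a \<Rightarrow> 'h) a b. ip D (\<eta> a) (\<eta> b))"
  \<comment> \<open>All real cocycles with the form prescribed by \<open>L\<close>. By
    \<open>equiv_iff\<close> the form is a complete invariant of unitary equivalence, so a nonempty
    set of this kind is exactly one class.\<close>
  define \<Phi> where "\<Phi> L = {p \<in> R. form p = generator_form \<epsilon> L}" for L
  have nonempty: "\<exists>p\<in>R. form p = generator_form \<epsilon> L" if L: "L \<in> I" for L
  proof -
    obtain D :: "'h prehilbert" and \<eta> where "(D, \<eta>) \<in> R"
      "\<And>a b. ip D (\<eta> a) (\<eta> b) = generator_form \<epsilon> L a b"
      using real_cocycle_of_generator[OF aut j L[unfolded I_def]] unfolding R_def by blast
    then show ?thesis by (intro bexI[of _ "(D, \<eta>)"]) (simp_all add: form_def fun_eq_iff)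
  qed
  have generator: "\<exists>L\<in>I. form p = generator_form \<epsilon> L" if "p \<in> R" for p
  proof (cases p)
    case (Pair D \<eta>)
    then have "(D, \<eta>) \<in> real_cocycles \<epsilon> (S \<circ> \<alpha>)" using that by (simp add: R_def)
    then obtain L where "L \<in> I" "\<And>a b. ip D (\<eta> a) (\<eta> b) = generator_form \<epsilon> L a b"
      using generator_of_real_cocycle[OF aut bij surj] unfolding I_def by blast
    then show ?thesis by (auto simp: Pair form_def fun_eq_iff)
  qed
  have equiv_iff: "unitarily_equivalent p q \<longleftrightarrow> form p = form q" if "p \<in> R" "q \<in> R" for p q
  proof (cases p; cases q)
    fix D1 \<eta>1 D2 \<eta>2 assume "p = (D1, \<eta>1)" "q = (D2, \<eta>2)"
    with that show ?thesis
      using unitarily_equivalent_iff_ip_eq[of D1 \<eta>1 D2 \<eta>2]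
      by (auto simp: R_def form_def real_cocycles_def fun_eq_iff dest: dense_linear_map_cocycle)
  qed
  define r where "r = {(p, q) \<in> R \<times> R. unitarily_equivalent p q}"
  have class_eq: "r `` {p} = \<Phi> L"
    if "p \<in> R" "form p = generator_form \<epsilon> L" for p L
    using that by (auto simp: r_def \<Phi>_def equiv_iff)
  have "bij_betw \<Phi> I (real_cocycle_classes \<epsilon> (S \<circ> \<alpha>))"
    unfolding bij_betw_def
  proof
    show "inj_on \<Phi> I"
    proof (rule inj_onI)
      fix L M assume L: "L \<in> I" and M: "M \<in> I" and eq: "\<Phi> L = \<Phi> M"
      obtain p where p: "p \<in> \<Phi> L" using nonempty[OF L] by (auto simp: \<Phi>_def)
      then have "p \<in> \<Phi> M" by (simp add: eq)
      with p have "generator_form \<epsilon> L = generator_form \<epsilon> M" by (simp add: \<Phi>_def)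
      then show "L = M"
        using inj_onD[OF generator_form_inj[OF aut bij_is_surj[OF bij]]] L M by (simp add: I_def)
    qed
    show "\<Phi> ` I = real_cocycle_classes \<epsilon> (S \<circ> \<alpha>)"
      unfolding real_cocycle_classes_def R_def[symmetric] r_def[symmetric]
    proof (intro equalityI subsetI)
      fix P assume "P \<in> \<Phi> ` I"
      then obtain L p where "P = \<Phi> L" "p \<in> R" "form p = generator_form \<epsilon> L"
        using nonempty by blast
      then show "P \<in> R // r"
        using quotientI[of p R r] class_eq[of p L] by simp
    next
      fix P assume "P \<in> R // r"
      then obtain p where p: "p \<in> R" "P = r `` {p}"
        by (rule quotientE)
      obtain L where "L \<in> I" "form p = generator_form \<epsilon> L" using generator[OF p(1)] by blast
      then show "P \<in> \<Phi> ` I" unfolding p(2) by (simp add: class_eq p(1))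
    qed
  qed
  \<comment> \<open>Equality of forms at \<open>star a\<close> is the coboundary identity at
    \<open>a\<close>.\<close>
  moreover have "yields_coboundary \<epsilon> D \<eta> L" if "L \<in> I" "(D, \<eta>) \<in> \<Phi> L" for L D \<eta>
    using that(2) generator_form_coboundary[of L]
    by (simp add: yields_coboundary_def \<Phi>_def form_def fun_eq_iff)
  ultimately show ?thesis unfolding I_def by blast
qed

end
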